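(* Let $m\ge1$ be an integer, let $\tilde H\in\Omega_{2n}$ be invertible and Hermitian, and let $\tilde B\in\Omega_{2n}$ be $\tilde H$-selfadjoint with $\sigma(\tilde B)=\{0\}$. Then there exists an $\tilde H$-selfadjoint $\tilde A\in\Omega_{2n}$ with $\tilde A^m=\tilde B$ if and only if the following hold: 1. There is a reordering of the Segre characteristic of $\tilde B$ (at $0$, with zeros allowed as entries) into $m$-tuples such that each $m$-tuple occurs twice and any two numbers in the same $m$-tuple differ by at most one. 2. Using such a reordering, there exist an invertible $S\in\Omega_{2n}$, an integer $t$, integers $a_j\ge0$ and $0<r_j\le m$ ($j=1,\dots,t$) and signs $\varepsilon^{(j)}_i\in\{1,-1\}$ such that $S^{-1}\tilde BS=J_B\oplus J_B$ and $S^*\tilde HS=H_B\oplus H_B$ (up to permutation of blocks), where $$J_B=\bigoplus_{j=1}^t\Big(\bigoplus_{i=1}^{r_j}J_{a_j+1}(0)\oplus\bigoplus_{i=r_j+1}^{m}J_{a_j}(0)\Big),\quad H_B=\bigoplus_{j=1}^t\Big(\bigoplus_{i=1}^{r_j}\varepsilon^{(j)}_iQ_{a_j+1}\oplus\bigoplus_{i=r_j+1}^{m}\varepsilon^{(j)}_iQ_{a_j}\Big),$$ and for each $j$ there is $\eta_j\in\{1,-1\}$ such that: among $\varepsilon^{(j)}_1,\dots,\varepsilon^{(j)}_{r_j}$, if $r_j$ is even then half equal $\eta_j$ and half equal $-\eta_j$, and if $r_j$ is odd then exactly one more equals $\eta_j$ than equals $-\eta_j$; the same rule (with the same $\eta_j$)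 holds for $\varepsilon^{(j)}_{r_j+1},\dots,\varepsilon^{(j)}_m$ with $m-r_j$ in place of $r_j$.
   Context: $\Omega_{2n}=\{\begin{bmatrix}A_1&\bar A_2\\-A_2&\bar A_1\end{bmatrix}: A_1,A_2\in\mathbb{C}^{n\times n}\}\subset\mathbb{C}^{2n\times 2n}$. $J_k(0)$: $k\times k$ nilpotent Jordan block; $Q_k$: $k\times k$ matrix with ones on the anti-diagonal and zeros elsewhere; $J_0(0)$ and $Q_0$ denote empty (absent) blocks. If the Jordan blocks of a matrix at $0$ are $J_{n_1}(0),\dots,J_{n_r}(0)$ with $n_1\ge\dots\ge n_r>0$, its Segre characteristic (at $0$) is $n_1,\dots,n_r,0,0,\dots$. For invertible Hermitian $H$, $A$ is $H$-selfadjoint if $HA=A^*H$. *)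

theory Defs
  imports "Jordan_Normal_Form.Jordan_Normal_Form" "HOL-Library.Multiset"
begin

definition adj :: "complex mat \<Rightarrow> complex mat" where
  "adj A = mat (dim_col A) (dim_row A) (\<lambda>(i,j). cnj (A $$ (j,i)))"

definition in_Omega :: "nat \<Rightarrow> complex mat \<Rightarrow> bool" where
  "in_Omega n M \<longleftrightarrow> (\<exists>A1 A2. A1 \<in> carrier_mat n n \<and> A2 \<in> carrier_mat n n \<and>
       M = four_block_mat A1 (map_mat cnj A2) (- A2) (map_mat cnj A1))"

definition hermitian :: "complex mat \<Rightarrow> bool" where
  "hermitian H \<longleftrightarrow> adj H = H"

definition H_selfadjoint :: "complex mat \<Rightarrow> complex mat \<Rightarrow> bool" where
  "H_selfadjoint H A \<longleftrightarrow> H * A = adj A * H"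

definition spectrum :: "complex mat \<Rightarrow> complex set" where
  "spectrum A = {z. eigenvalue A z}"

definition Qmat :: "nat \<Rightarrow> complex mat" where
  "Qmat k = mat k k (\<lambda>(i,j). if i + j = k - 1 then 1 else 0)"

(* Segre characteristic at lambda: the multiset of sizes of the Jordan blocks at lambda
   (only the positive entries; the trailing zeros are implicit) *)
definition segre :: "complex mat \<Rightarrow> complex \<Rightarrow> nat multiset" where
  "segre A c = (THE M. \<exists>n_as. jordan_nf A n_as \<and>
                        M = mset (map fst (filter (\<lambda>p. snd p = c) n_as)))"

(* Condition 1: the Segre characteristic (zeros allowed as entries) can be reordered into
   m-tuples, each m-tuple occurring twice, entries of a tuple differing by at most one.
   K lists each tuple once; the full collection of tuples is K + K. *)
definition segre_pairable :: "nat \<Rightarrow> nat multiset \<Rightarrow> bool" where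
  "segre_pairable m S \<longleftrightarrow> (\<exists>K :: nat list multiset.
      (\<forall>\<tau>\<in>#K. length \<tau> = m \<and> (\<forall>x\<in>set \<tau>. \<forall>y\<in>set \<tau>. x \<le> y + 1)) \<and>
      filter_mset (\<lambda>x. x \<noteq> 0) (\<Sum>\<tau>\<in>#(K + K). mset \<tau>) = S)"

definition tuple :: "nat \<Rightarrow> nat \<Rightarrow> nat \<Rightarrow> nat list" where
  "tuple m a r = replicate r (a + 1) @ replicate (m - r) a"

definition JB :: "nat \<Rightarrow> nat \<Rightarrow> (nat \<Rightarrow> nat) \<Rightarrow> (nat \<Rightarrow> nat) \<Rightarrow> complex mat" where
  "JB m t a r = diag_block_mat (concat (map (\<lambda>j. map (\<lambda>i.
       jordan_block (if i \<le> r j then a j + 1 else a j) (0::complex)) [1..<m+1]) [1..<t+1]))"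

definition HB :: "nat \<Rightarrow> nat \<Rightarrow> (nat \<Rightarrow> nat) \<Rightarrow> (nat \<Rightarrow> nat) \<Rightarrow> (nat \<Rightarrow> nat \<Rightarrow> int) \<Rightarrow> complex mat" where
  "HB m t a r eps = diag_block_mat (concat (map (\<lambda>j. map (\<lambda>i.
       of_int (eps j i) \<cdot>\<^sub>m Qmat (if i \<le> r j then a j + 1 else a j)) [1..<m+1]) [1..<t+1]))"

definition balanced_signs :: "(nat \<Rightarrow> int) \<Rightarrow> nat set \<Rightarrow> int \<Rightarrow> bool" where
  "balanced_signs e I \<eta> \<longleftrightarrow>
     (if even (card I) then card {i\<in>I. e i = \<eta>} = card {i\<in>I. e i = - \<eta>}
      else card {i\<in>I. e i = \<eta>} = card {i\<in>I. e i = - \<eta>} + 1)"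

end

theory Submission
  imports Defs "Jordan_Normal_Form.Jordan_Normal_Form_Existence"
    "Jordan_Normal_Form.Jordan_Normal_Form_Uniqueness"
begin

text \<open>
  Matrices in $\Omega_{2n}$ are those commuting with the antilinear map $\phi(v) = J \bar v$,
  where $J = [[0,-1],[1,0]]$, that is, quaternionic matrices. If $G$ is Hermitian and commutes with
  $\phi$, then $\phi(x)^* G x = 0$ for every $x$. So for a nilpotent $H$-selfadjoint $A$ one can
  split off $H$-orthogonal Jordan chains one at a time: pick $x$ in the orthogonal complement $W$
  of the chains found so far with $x^* H A^{k-1} x \neq 0$, where $k$ is the nilpotency index of
  $A$ on $W$, make $x^* H A^p x$ vanish for $p < k - 1$ by adding real multiples of $A^s x$, and take
  the chains of $x$ and $\phi(x)$. This gives the canonical form $(J \oplus J, Q \oplus Q)$ of $(A,H)$.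

  The $m$-th power of a single block $(J_k(0), \eta Q_k)$, $k = am + r$ with $0 < r \le m$, splits
  into $m$ chains according to the index modulo $m$. The form pairs chain $g$ with the reflected chain
  of the same length, and diagonalising the pairs gives signs $\eta, -\eta$ for each pair
  and $\eta$ for a self-paired chain; this is exactly the sign condition. As the change of
  basis is real, it doubles to an element of $\Omega_{2n}$ and can be used in both directions.
\<close>

text \<open>Both implications rest on one identity, for the \<open>m\<close>-th power of a canonical
  block. The canonical form is taken of the given root \<open>A\<close>, not of \<open>B\<close>;
  taking powers blockwise then gives the form of \<open>B\<close>. Conversely, the sizes
  \<open>a j * m + r j\<close> and the signs \<eta> read off from condition 2 define canonical
  matrices, and the same identity transports them back to a root.

  The chains of x and phi(x) carry equal signs because phi turns a Gram matrix into its complex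
  conjugate and the canonical matrices are real; this is why every block occurs doubled with the
  same sign.

  A vector x with x^* H A^(k-1) x nonzero exists because H stays nondegenerate on W: W is the
  H-orthogonal complement of a subspace on which the Gram matrix squares to the identity. A nonzero
  vector of A^(k-1) W therefore pairs with some vector of W, and polarization replaces such a pair
  by a single vector.\<close>

lemma adj_dim [simp]: "dim_row (adj A) = dim_col A" "dim_col (adj A) = dim_row A"
  by (simp_all add: adj_def)

lemma adj_carrier [simp, intro]: "A \<in> carrier_mat r c \<Longrightarrow> adj A \<in> carrier_mat c r"
  by (auto simp: adj_def)

lemma adj_index [simp]: "i < dim_col A \<Longrightarrow> j < dim_row A \<Longrightarrow> adj A $$ (i,j) = cnj (A $$ (j,i))"
  by (simp add: adj_def)

lemma adj_adj [simp]: "adj (adj A) = A"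
  by (rule eq_matI) auto

lemma adj_zero [simp]: "adj (0\<^sub>m r c) = 0\<^sub>m c r"
  by (rule eq_matI) auto

lemma adj_mult: "dim_col A = dim_row B \<Longrightarrow> adj (A * B) = adj B * adj A"
  by (rule eq_matI) (auto simp: scalar_prod_def mult.commute)

lemma cnj_mat_mult: "dim_col A = dim_row B \<Longrightarrow> map_mat cnj (A * B) = map_mat cnj A * map_mat cnj B"
  by (rule eq_matI) (auto simp: scalar_prod_def)

lemma adj_cnj_mat: "adj (map_mat cnj A) = map_mat cnj (adj A)"
  by (rule eq_matI) auto

lemma cnj_cnj_mat [simp]: "map_mat cnj (map_mat cnj A) = A"
  by (rule eq_matI) auto

definition hcat :: "complex mat \<Rightarrow> complex mat \<Rightarrow> complex mat" where
  "hcat A B = mat (dim_row A) (dim_col A + dim_col B)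
     (\<lambda>(i,j). if j < dim_col A then A $$ (i,j) else B $$ (i, j - dim_col A))"

lemma hcat_dim [simp]: "dim_row (hcat A B) = dim_row A" "dim_col (hcat A B) = dim_col A + dim_col B"
  by (simp_all add: hcat_def)

lemma hcat_carrier [simp, intro]:
  "A \<in> carrier_mat r a \<Longrightarrow> B \<in> carrier_mat r b \<Longrightarrow> hcat A B \<in> carrier_mat r (a + b)"
  by (auto simp: hcat_def)

lemma hcat_index [simp]: "i < dim_row A \<Longrightarrow> j < dim_col A + dim_col B \<Longrightarrow>
  hcat A B $$ (i,j) = (if j < dim_col A then A $$ (i,j) else B $$ (i, j - dim_col A))"
  by (simp add: hcat_def)

lemma mult_hcat:
  assumes "dim_col M = dim_row A" "dim_row B = dim_row A"
  shows "M * hcat A B = hcat (M * A) (M * B)"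
  using assms by (intro eq_matI) (auto simp: scalar_prod_def)

lemma cnj_hcat: "dim_row B = dim_row A \<Longrightarrow> map_mat cnj (hcat A B) = hcat (map_mat cnj A) (map_mat cnj B)"
  by (rule eq_matI) auto

lemma adj_hcat_mult_hcat:
  assumes "dim_row B = dim_row A" "dim_row C = dim_row A" "dim_row D = dim_row A"
  shows "adj (hcat A B) * hcat C D
    = four_block_mat (adj A * C) (adj A * D) (adj B * C) (adj B * D)"
  using assms by (intro eq_matI) (auto simp: scalar_prod_def)

text \<open>Applied when \<open>A * X\<close> and \<open>B * Y\<close> are the images of
  \<open>A\<close> and \<open>B\<close> under some matrix, this says that joining bases of two
  invariant subspaces puts that matrix into block-diagonal form.\<close>

lemma hcat_mult_diag:
  assumes A: "A \<in> carrier_mat d a" and B: "B \<in> carrier_mat d b"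
    and X: "X \<in> carrier_mat a a'" and Y: "Y \<in> carrier_mat b b'"
  shows "hcat A B * four_block_mat X (0\<^sub>m a b') (0\<^sub>m b a') Y = hcat (A * X) (B * Y)"
proof (rule eq_matI, goal_cases)
  case (1 i j)
  have split: "(\<Sum>k = 0..<a + b. f k) = (\<Sum>k = 0..<a. f k) + (\<Sum>k = 0..<b. f (k + a))"
    for f :: "nat \<Rightarrow> complex"
    using sum.atLeastLessThan_concat[of 0 a "a+b" f]
      sum.shift_bounds_nat_ivl[of f 0 a b] by (simp add: add.commute)
  show ?case using 1 A B X Y by (auto simp: scalar_prod_def split)
qed (use assms in auto)

section \<open>The quaternionic structure\<close>

definition quat_J :: "nat \<Rightarrow> complex mat" where
  "quat_J n = four_block_mat (0\<^sub>m n n) (- 1\<^sub>m n) (1\<^sub>m n) (0\<^sub>m n n)"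

text \<open>The antilinear map phi of the overview, acting on all columns at once.\<close>

definition quat_conj :: "nat \<Rightarrow> complex mat \<Rightarrow> complex mat" where
  "quat_conj n Y = quat_J n * map_mat cnj Y"

lemma quat_J_carrier [simp, intro]: "quat_J n \<in> carrier_mat (2*n) (2*n)"
  by (auto simp: quat_J_def mult_2 intro!: four_block_carrier_mat)

lemma quat_J_dim [simp]: "dim_row (quat_J n) = 2*n" "dim_col (quat_J n) = 2*n"
  by (rule carrier_matD[OF quat_J_carrier])+

lemma quat_conj_carrier [simp, intro]:
  "Y \<in> carrier_mat (2*n) c \<Longrightarrow> quat_conj n Y \<in> carrier_mat (2*n) c"
  by (auto simp: quat_conj_def)

lemma quat_conj_dim [simp]: "dim_row (quat_conj n Y) = 2*n" "dim_col (quat_conj n Y) = dim_col Y"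
  by (auto simp: quat_conj_def)

lemma cnj_quat_J [simp]: "map_mat cnj (quat_J n) = quat_J n"
  by (rule eq_matI) (auto simp: quat_J_def)

lemma adj_quat_J: "adj (quat_J n) = - quat_J n"
  by (rule eq_matI) (auto simp: quat_J_def)

text \<open>Multiplication by \<open>quat_J\<close> only permutes and negates the four blocks, so
  commutation with phi becomes two equations: the lower right block is the conjugate of the upper
  left one, and the upper right block is minus the conjugate of the lower left one. Closure under
  products and inverses is then proved without touching blocks.\<close>

lemma in_Omega_iff:
  "in_Omega n M \<longleftrightarrow> M \<in> carrier_mat (2*n) (2*n) \<and> M * quat_J n = quat_J n * map_mat cnj M"
proof
  assume "in_Omega n M"
  then obtain A B where A: "A \<in> carrier_mat n n" and B: "B \<in> carrier_mat n n"
    and M: "M = four_block_mat A (map_mat cnj B) (- B) (map_mat cnj A)"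
    unfolding in_Omega_def by blast
  have cM: "map_mat cnj M = four_block_mat (map_mat cnj A) B (- map_mat cnj B) A"
    using A B by (intro eq_matI) (auto simp: M)
  have cA: "map_mat cnj A \<in> carrier_mat n n" and cB: "map_mat cnj B \<in> carrier_mat n n"
    and nB: "- B \<in> carrier_mat n n" and ncB: "- map_mat cnj B \<in> carrier_mat n n" using A B by auto
  have "M * quat_J n = four_block_mat (map_mat cnj B) (- A) (map_mat cnj A) B"
    unfolding M quat_J_def
    by (subst mult_four_block_mat[OF A cB nB cA, of _ n _ n]) (use A B cA cB nB ncB in auto)
  moreover have "quat_J n * map_mat cnj M = four_block_mat (map_mat cnj B) (- A) (map_mat cnj A) B"
    unfolding cM quat_J_def
    by (subst mult_four_block_mat[of _ n n _ n _ n]) (use A B cA cB nB ncB in auto)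
  moreover have "M \<in> carrier_mat (2*n) (2*n)" using A B by (auto simp: M)
  ultimately show "M \<in> carrier_mat (2*n) (2*n) \<and> M * quat_J n = quat_J n * map_mat cnj M" by simp
next
  assume M: "M \<in> carrier_mat (2*n) (2*n) \<and> M * quat_J n = quat_J n * map_mat cnj M"
  obtain A B C D where s: "split_block M n n = (A,B,C,D)" by (metis prod_cases4)
  have blocks: "A \<in> carrier_mat n n" "B \<in> carrier_mat n n" "C \<in> carrier_mat n n" "D \<in> carrier_mat n n"
    and MM: "M = four_block_mat A B C D"
    using split_block[OF s, of n n] M by (auto simp: mult_2)
  have cM: "map_mat cnj M = four_block_mat (map_mat cnj A) (map_mat cnj B) (map_mat cnj C) (map_mat cnj D)"
    using blocks by (intro eq_matI) (auto simp: MM)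
  have "M * quat_J n = four_block_mat B (- A) D (- C)"
    unfolding MM quat_J_def
    by (subst mult_four_block_mat[of _ n n _ n _ n]) (use blocks in auto)
  moreover have "quat_J n * map_mat cnj M
      = four_block_mat (- map_mat cnj C) (- map_mat cnj D) (map_mat cnj A) (map_mat cnj B)"
    unfolding cM quat_J_def
    by (subst mult_four_block_mat[of _ n n _ n _ n]) (use blocks in auto)
  ultimately have eq: "four_block_mat B (- A) D (- C)
     = four_block_mat (- map_mat cnj C) (- map_mat cnj D) (map_mat cnj A) (map_mat cnj B)"
    using M by simp
  have BC: "B = map_mat cnj (- C)"
  proof (rule eq_matI)
    fix i j assume "i < dim_row (map_mat cnj (- C))" "j < dim_col (map_mat cnj (- C))"
    with blocks arg_cong[OF eq, of "\<lambda>X. X $$ (i,j)"]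
    show "B $$ (i,j) = map_mat cnj (- C) $$ (i,j)" by auto
  qed (use blocks in auto)
  have DA: "D = map_mat cnj A"
  proof (rule eq_matI)
    fix i j assume "i < dim_row (map_mat cnj A)" "j < dim_col (map_mat cnj A)"
    with blocks arg_cong[OF eq, of "\<lambda>X. X $$ (n + i,j)"]
    show "D $$ (i,j) = map_mat cnj A $$ (i,j)" by auto
  qed (use blocks in auto)
  show "in_Omega n M" unfolding in_Omega_def
    by (rule exI[of _ A], rule exI[of _ "- C"]) (use blocks BC DA MM in auto)
qed

lemma in_Omega_carrier: "in_Omega n M \<Longrightarrow> M \<in> carrier_mat (2*n) (2*n)"
  by (simp add: in_Omega_iff)

lemma in_Omega_mult:
  assumes "in_Omega n M" "in_Omega n N"
  shows "in_Omega n (M * N)"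
proof -
  have c: "M \<in> carrier_mat (2*n) (2*n)" "N \<in> carrier_mat (2*n) (2*n)"
    and M: "M * quat_J n = quat_J n * map_mat cnj M" and N: "N * quat_J n = quat_J n * map_mat cnj N"
    using assms by (auto simp: in_Omega_iff)
  have "M * N * quat_J n = M * (N * quat_J n)" using c by (intro assoc_mult_mat) auto
  also have "\<dots> = M * quat_J n * map_mat cnj N" unfolding N using c
    by (intro assoc_mult_mat[symmetric]) auto
  also have "\<dots> = quat_J n * (map_mat cnj M * map_mat cnj N)" unfolding M using c
    by (intro assoc_mult_mat) auto
  finally show ?thesis using c by (simp add: in_Omega_iff cnj_mat_mult)
qed

lemma in_Omega_inverse:
  assumes S: "in_Omega n S" and T: "T \<in> carrier_mat (2*n) (2*n)"
    and "S * T = 1\<^sub>m (2*n)" and "T * S = 1\<^sub>m (2*n)"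
  shows "in_Omega n T"
proof -
  let ?K = "quat_J n" and ?c = "map_mat cnj"
  have c: "S \<in> carrier_mat (2*n) (2*n)" and SK: "S * ?K = ?K * ?c S"
    using S by (auto simp: in_Omega_iff)
  have cST: "?c S * ?c T = 1\<^sub>m (2*n)"
    using c T by (subst cnj_mat_mult[symmetric]) (auto simp: assms(3) intro!: eq_matI)
  have "T * ?K = T * (?K * (?c S * ?c T))" unfolding cST using T by simp
  also have "\<dots> = T * (?K * ?c S * ?c T)" using c T
    by (subst assoc_mult_mat[of ?K "2*n" "2*n" "?c S" "2*n" "?c T" "2*n"]) auto
  also have "\<dots> = T * (S * ?K * ?c T)" unfolding SK ..
  also have "\<dots> = T * (S * (?K * ?c T))" using c T
    by (subst assoc_mult_mat[of S "2*n" "2*n" ?K "2*n" "?c T" "2*n"]) auto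
  also have "\<dots> = T * S * (?K * ?c T)" using c T
    by (subst assoc_mult_mat[of T "2*n" "2*n" S "2*n" "?K * ?c T" "2*n"]) auto
  also have "\<dots> = ?K * ?c T" unfolding assms(4) using T by (intro left_mult_one_mat) auto
  finally show ?thesis using T by (simp add: in_Omega_iff)
qed

text \<open>The second diagonal block of a matrix in Omega is the conjugate of the first, so only a
  real matrix can be repeated. The changes of basis for powers are therefore kept real.\<close>

lemma in_Omega_double:
  assumes "R \<in> carrier_mat n n" and "map_mat cnj R = R"
  shows "in_Omega n (diag_block_mat [R, R])"
  unfolding in_Omega_def
  by (rule exI[of _ R], rule exI[of _ "0\<^sub>m n n"]) (use assms in \<open>auto intro!: cong_four_block_mat\<close>)

text \<open>In an Omega matrix the right half is the image of the left half under phi. It thus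
  suffices to construct \<open>n\<close> columns; adjoining their images lands in Omega
  automatically.\<close>

lemma in_Omega_hcat_quat_conj:
  assumes Y: "Y \<in> carrier_mat (2*n) n"
  shows "in_Omega n (hcat Y (quat_conj n Y))"
proof -
  let ?A = "mat n n (\<lambda>(i,j). Y $$ (i,j))" and ?B = "mat n n (\<lambda>(i,j). - Y $$ (n + i, j))"
  \<comment> \<open>The right-hand blocks have no columns: this cuts \<open>Y\<close> into its upper
    and lower half.\<close>
  have sp: "Y = four_block_mat ?A (0\<^sub>m n 0) (- ?B) (0\<^sub>m n 0)"
    using Y by (intro eq_matI) auto
  have cY: "map_mat cnj Y = four_block_mat (map_mat cnj ?A) (0\<^sub>m n 0) (- map_mat cnj ?B) (0\<^sub>m n 0)"
    using Y by (intro eq_matI) auto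
  have q: "quat_conj n Y = four_block_mat (map_mat cnj ?B) (0\<^sub>m n 0) (map_mat cnj ?A) (0\<^sub>m n 0)"
    unfolding quat_conj_def cY quat_J_def
    by (subst mult_four_block_mat[of _ n n _ n _ n]) (auto intro!: cong_four_block_mat)
  show ?thesis unfolding in_Omega_def
    by (rule exI[of _ ?A], rule exI[of _ ?B], intro conjI)
      (use Y in \<open>auto simp: q intro!: eq_matI\<close>)
qed

lemma quat_conj_hcat: "dim_row X = 2*n \<Longrightarrow> dim_row Y = 2*n \<Longrightarrow>
  quat_conj n (hcat X Y) = hcat (quat_conj n X) (quat_conj n Y)"
  by (simp add: quat_conj_def cnj_hcat mult_hcat)

section \<open>Block-diagonal matrices and a dimension count\<close>

lemma diag_block_mat_Cons:
  assumes "X \<in> carrier_mat a b" and "diag_block_mat Xs \<in> carrier_mat c d"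
  shows "diag_block_mat (X # Xs) = four_block_mat X (0\<^sub>m a d) (0\<^sub>m c b) (diag_block_mat Xs)"
  using assms by (auto simp: Let_def)

lemma diag_block_mat_pair:
  "diag_block_mat [A,B] = four_block_mat A (0\<^sub>m (dim_row A) (dim_col B)) (0\<^sub>m (dim_row B) (dim_col A)) B"
  unfolding diag_block_mat.simps(2)[of A] Let_def diag_block_mat_singleton ..

lemma diag_block_mat_mult:
  assumes "\<And>x. x \<in> set xs \<Longrightarrow> dim_col (f x) = dim_row (g x)"
  shows "diag_block_mat (map f xs) * diag_block_mat (map g xs) = diag_block_mat (map (\<lambda>x. f x * g x) xs)"
  using assms
proof (induction xs)
  case (Cons x xs)
  let ?F = "diag_block_mat (map f xs)" and ?G = "diag_block_mat (map g xs)"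
  let ?H = "diag_block_mat (map (\<lambda>x. f x * g x) xs)"
  have dims: "map dim_col (map f xs) = map dim_row (map g xs)" using Cons by auto
  have FG: "dim_col ?F = dim_row ?G" using dims by (simp only: dim_diag_block_mat)
  have IH: "?F * ?G = ?H" using Cons by auto
  have H: "dim_row ?H = dim_row ?F" "dim_col ?H = dim_col ?G" unfolding IH[symmetric] by auto
  show ?case using Cons.prems FG H
    unfolding list.simps diag_block_mat.simps Let_def
    by (subst mult_four_block_mat[of _ "dim_row (f x)" "dim_row (g x)" _ "dim_row ?G" _ "dim_row ?F"
          _ _ "dim_col (g x)" _ "dim_col ?G"])
      (auto simp: IH)
qed auto

lemma adj_four_block_mat:
  assumes "A \<in> carrier_mat a b" "B \<in> carrier_mat a d" "C \<in> carrier_mat c b" "D \<in> carrier_mat c d"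
  shows "adj (four_block_mat A B C D) = four_block_mat (adj A) (adj C) (adj B) (adj D)"
  using assms by (intro eq_matI) auto

lemma adj_diag_block_mat: "adj (diag_block_mat Xs) = diag_block_mat (map adj Xs)"
proof (induction Xs)
  case (Cons X Xs)
  have "dim_row (diag_block_mat (map adj Xs)) = dim_col (diag_block_mat Xs)"
    "dim_col (diag_block_mat (map adj Xs)) = dim_row (diag_block_mat Xs)"
    unfolding Cons[symmetric] by simp_all
  then show ?case unfolding list.simps diag_block_mat.simps Let_def
    by (subst adj_four_block_mat[of _ "dim_row X" "dim_col X" _ "dim_col (diag_block_mat Xs)" _ "dim_row (diag_block_mat Xs)"])
     (auto simp: Cons)
qed auto

lemma cnj_diag_block_mat: "map_mat cnj (diag_block_mat Xs) = diag_block_mat (map (map_mat cnj) Xs)"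
proof (induction Xs)
  case (Cons X Xs)
  have "dim_row (diag_block_mat (map (map_mat cnj) Xs)) = dim_row (diag_block_mat Xs)"
    "dim_col (diag_block_mat (map (map_mat cnj) Xs)) = dim_col (diag_block_mat Xs)"
    unfolding Cons[symmetric] by simp_all
  then show ?case unfolding list.simps diag_block_mat.simps Let_def Cons[symmetric]
    by (intro eq_matI) auto
qed auto

lemma diag_block_mat_concat: "diag_block_mat (concat Xss) = diag_block_mat (map diag_block_mat Xss)"
  by (induction Xss) (simp_all add: diag_block_mat_append Let_def)

text \<open>If p < q, padding \<open>X\<close> with zero rows and \<open>Z\<close> with zero columns
  gives square matrices whose product is still the identity, although the padded \<open>X\<close>
  has a zero row and determinant 0. This count bounds the size of frames and shows that an
  incomplete frame does not span.\<close>

lemma left_inverse_dim_le: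
  fixes X Z :: "complex mat"
  assumes X: "X \<in> carrier_mat p q" and Z: "Z \<in> carrier_mat q p" and ZX: "Z * X = 1\<^sub>m q"
  shows "q \<le> p"
proof (rule ccontr)
  assume "\<not> q \<le> p"
  then have qp: "p < q" by simp
  define X' where "X' = four_block_mat X (0\<^sub>m p 0) (0\<^sub>m (q-p) q) (0\<^sub>m (q-p) 0)"
  define Z' where "Z' = four_block_mat Z (0\<^sub>m q (q-p)) (0\<^sub>m 0 p) (0\<^sub>m 0 (q-p))"
  have c: "X' \<in> carrier_mat q q" "Z' \<in> carrier_mat q q" using X Z qp by (auto simp: X'_def Z'_def)
  have "Z' * X' = four_block_mat (Z * X) (0\<^sub>m q 0) (0\<^sub>m 0 q) (0\<^sub>m 0 0)"
    unfolding X'_def Z'_def using X Z qp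
    by (subst mult_four_block_mat[of _ q p _ "q-p" _ 0 _ _ q _ 0]) auto
  also have "\<dots> = 1\<^sub>m q" unfolding ZX by (intro eq_matI) auto
  finally have "det Z' * det X' = 1" using det_mult[OF c(2,1)] by simp
  moreover have "det X' = 0"
  proof -
    have row: "row X' (q-1) = 0\<^sub>v q" using X qp
      by (intro eq_vecI) (auto simp: X'_def)
    have "det X' = (\<Sum>j<q. X' $$ (q-1, j) * cofactor X' (q-1) j)"
      using laplace_expansion_row[OF c(1), of "q-1"] qp by simp
    also have "\<dots> = 0"
    proof (rule sum.neutral, intro ballI)
      fix j assume "j \<in> {..<q}"
      then have "X' $$ (q-1,j) = row X' (q-1) $ j" using c qp by auto
      then show "X' $$ (q-1, j) * cofactor X' (q-1) j = 0" using row \<open>j \<in> {..<q}\<close> by simp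
    qed
    finally show ?thesis .
  qed
  ultimately show False by simp
qed

lemma mat_assoc: "dim_col A = dim_row B \<Longrightarrow> dim_col B = dim_row C \<Longrightarrow> A * B * C = A * (B * (C :: complex mat))"
  by (rule assoc_mult_mat[of _ "dim_row A" "dim_row B" _ "dim_row C" _ "dim_col C"]) auto

lemma mat_vec_assoc: "dim_col A = dim_row B \<Longrightarrow> dim_col B = dim_vec v \<Longrightarrow> A * B *\<^sub>v v = A *\<^sub>v (B *\<^sub>v (v :: complex vec))"
  by (rule assoc_mult_mat_vec[of _ "dim_row A" "dim_row B" _ "dim_vec v"]) auto

section \<open>The standard inner product\<close>

definition ip :: "complex vec \<Rightarrow> complex vec \<Rightarrow> complex" where
  "ip u v = (\<Sum>i<dim_vec v. cnj (u $ i) * v $ i)"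

lemma ip_mult_mat_vec:
  assumes M: "M \<in> carrier_mat r c" and u: "u \<in> carrier_vec r" and v: "v \<in> carrier_vec c"
  shows "ip u (M *\<^sub>v v) = ip (adj M *\<^sub>v u) v"
proof -
  have "ip u (M *\<^sub>v v) = (\<Sum>i<r. \<Sum>j<c. cnj (u $ i) * (M $$ (i,j) * v $ j))"
    using assms by (auto simp: ip_def scalar_prod_def sum_distrib_left atLeast0LessThan intro!: sum.cong)
  also have "\<dots> = (\<Sum>j<c. \<Sum>i<r. cnj (u $ i) * (M $$ (i,j) * v $ j))"
    by (rule sum.swap)
  also have "\<dots> = ip (adj M *\<^sub>v u) v"
    using assms by (auto simp: ip_def scalar_prod_def sum_distrib_left sum_distrib_right atLeast0LessThan ac_simps intro!: sum.cong)
  finally show ?thesis .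
qed

lemma ip_add_right: "u \<in> carrier_vec d \<Longrightarrow> v \<in> carrier_vec d \<Longrightarrow> w \<in> carrier_vec d \<Longrightarrow> ip u (v + w) = ip u v + ip u w"
  by (auto simp: ip_def algebra_simps sum.distrib)

lemma ip_add_left: "u \<in> carrier_vec d \<Longrightarrow> v \<in> carrier_vec d \<Longrightarrow> w \<in> carrier_vec d \<Longrightarrow> ip (u + v) w = ip u w + ip v w"
  by (auto simp: ip_def algebra_simps sum.distrib)

lemma ip_smult_right: "ip u (c \<cdot>\<^sub>v v) = c * ip u v"
  by (auto simp: ip_def sum_distrib_left ac_simps)

lemma ip_smult_left: "dim_vec u = dim_vec v \<Longrightarrow> ip (c \<cdot>\<^sub>v u) v = cnj c * ip u v"
  by (auto simp: ip_def sum_distrib_left ac_simps)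

lemma ip_uminus_left: "dim_vec u = dim_vec v \<Longrightarrow> ip (- u) v = - ip u v"
  by (auto simp: ip_def sum_negf)

lemma ip_zero_right [simp]: "ip u (0\<^sub>v d) = 0"
  by (auto simp: ip_def)

lemma cnj_ip: "dim_vec u = dim_vec v \<Longrightarrow> cnj (ip u v) = ip v u"
  by (auto simp: ip_def ac_simps)

lemma ip_self_eq_0: assumes "u \<in> carrier_vec d" "ip u u = 0" shows "u = 0\<^sub>v d"
proof -
  have "ip u u = of_real (\<Sum>i<d. (cmod (u $ i))\<^sup>2)"
    using assms(1) unfolding ip_def of_real_sum
    by (intro sum.cong) (simp_all add: complex_norm_square mult.commute del: of_real_power)
  with assms have "(\<Sum>i<d. (cmod (u $ i))\<^sup>2) = 0" by (metis of_real_eq_0_iff)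
  then have "\<forall>i<d. u $ i = 0" by (subst (asm) sum_nonneg_eq_0_iff) auto
  with assms show ?thesis by (intro eq_vecI) auto
qed

lemma adj_mult_index:
  "dim_row X = dim_row Z \<Longrightarrow> i < dim_col X \<Longrightarrow> j < dim_col Z \<Longrightarrow> (adj X * Z) $$ (i,j) = ip (col X i) (col Z j)"
  by (auto simp: ip_def scalar_prod_def atLeast0LessThan)

lemma map_vec_cnj_mult: "dim_col M = dim_vec v \<Longrightarrow> map_vec cnj (M *\<^sub>v v) = map_mat cnj M *\<^sub>v map_vec cnj v"
  by (rule eq_vecI) (auto simp: scalar_prod_def)

lemma ip_cnj_commute: "dim_vec u = dim_vec v \<Longrightarrow> ip (map_vec cnj u) v = ip (map_vec cnj v) u"
  by (auto simp: ip_def ac_simps)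

lemma pow_mat_add:
  assumes "A \<in> carrier_mat d d"
  shows "A ^\<^sub>m (p + q) = A ^\<^sub>m p * (A ^\<^sub>m q :: complex mat)"
  using assms by (induction q) (auto simp: mat_assoc)

section \<open>The canonical pair of a Jordan matrix and a signed reversal matrix\<close>

lemma Qmat_carrier [simp, intro]: "Qmat k \<in> carrier_mat k k"
  by (auto simp: Qmat_def)

lemma Qmat_mult_self [simp]: "Qmat k * Qmat k = 1\<^sub>m k"
proof (rule eq_matI)
  fix i j assume "i < dim_row (1\<^sub>m k)" "j < dim_col (1\<^sub>m k)"
  then have ij: "i < k" "j < k" by auto
  have "(Qmat k * Qmat k) $$ (i,j) = (\<Sum>l = 0..<k. if l = k - 1 - i then (if l + j = k - 1 then 1 else 0) else 0)"
  proof -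
    have eq: "i + l = k - 1 \<longleftrightarrow> l = k - 1 - i" for l using ij by auto
    show ?thesis using ij
      by (simp add: Qmat_def scalar_prod_def eq[simplified] if_distrib[of "\<lambda>x. x * _"] cong: if_cong)
  qed
  also have "\<dots> = (if k - 1 - i + j = k - 1 then 1 else 0)" using ij by (subst sum.delta) auto
  also have "\<dots> = 1\<^sub>m k $$ (i,j)" using ij by auto
  finally show "(Qmat k * Qmat k) $$ (i,j) = 1\<^sub>m k $$ (i,j)" .
qed (auto simp: Qmat_def)

definition jordan_blocks :: "(nat \<times> int) list \<Rightarrow> complex mat" where
  "jordan_blocks ks = diag_block_mat (map (\<lambda>(k,e). jordan_block k 0) ks)"

text \<open>\<open>sip\<close> stands for standard involutory permutation, a usual name of the
  matrix \<open>Qmat k\<close>. Each pair in the list is a block size with its sign, so that this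
  matrix and \<open>jordan_blocks\<close> share one index.\<close>

definition sip_blocks :: "(nat \<times> int) list \<Rightarrow> complex mat" where
  "sip_blocks ks = diag_block_mat (map (\<lambda>(k,e). of_int e \<cdot>\<^sub>m Qmat k) ks)"

definition blocks_dim :: "(nat \<times> int) list \<Rightarrow> nat" where
  "blocks_dim ks = sum_list (map fst ks)"

lemma jordan_blocks_carrier [simp, intro]: "jordan_blocks ks \<in> carrier_mat (blocks_dim ks) (blocks_dim ks)"
  unfolding jordan_blocks_def blocks_dim_def
  by (rule carrier_matI; induction ks) (auto simp: dim_diag_block_mat)

lemma sip_blocks_carrier [simp, intro]: "sip_blocks ks \<in> carrier_mat (blocks_dim ks) (blocks_dim ks)"
  unfolding sip_blocks_def blocks_dim_def
  by (rule carrier_matI; induction ks) (auto simp: dim_diag_block_mat Qmat_def)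

lemmas blocks_dims [simp] = carrier_matD[OF jordan_blocks_carrier] carrier_matD[OF sip_blocks_carrier]

lemma cnj_jordan_blocks [simp]: "map_mat cnj (jordan_blocks ks) = jordan_blocks ks"
  unfolding jordan_blocks_def cnj_diag_block_mat map_map
  by (rule arg_cong[of _ _ diag_block_mat], rule map_cong) (auto simp: jordan_block_def intro!: eq_matI)

lemma cnj_sip_blocks [simp]: "map_mat cnj (sip_blocks ks) = sip_blocks ks"
  unfolding sip_blocks_def cnj_diag_block_mat map_map
  by (rule arg_cong[of _ _ diag_block_mat], rule map_cong) (auto simp: Qmat_def intro!: eq_matI)

lemma smult_Qmat_mult_self: "e \<in> {1,-1} \<Longrightarrow> (of_int e \<cdot>\<^sub>m Qmat k) * (of_int e \<cdot>\<^sub>m Qmat k) = 1\<^sub>m k"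
  by (subst mult_smult_assoc_mat[of _ k k _ k], simp, simp, subst mult_smult_distrib[of _ k k _ k])
    (auto intro!: eq_matI)

text \<open>The index set is left arbitrary because the lemma serves both lists of (size, sign)
  pairs and the doubly indexed family in \<open>HB\<close>.\<close>

lemma diag_smult_Qmat_mult_self:
  assumes "\<And>x. x \<in> set xs \<Longrightarrow> e x \<in> {1,-1}"
  shows "diag_block_mat (map (\<lambda>x. of_int (e x) \<cdot>\<^sub>m Qmat (k x)) xs) *
    diag_block_mat (map (\<lambda>x. of_int (e x) \<cdot>\<^sub>m Qmat (k x)) xs) = 1\<^sub>m (sum_list (map k xs))"
proof -
  have "diag_block_mat (map (\<lambda>x. of_int (e x) \<cdot>\<^sub>m Qmat (k x)) xs) *
    diag_block_mat (map (\<lambda>x. of_int (e x) \<cdot>\<^sub>m Qmat (k x)) xs)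
    = diag_block_mat (map (\<lambda>x. (of_int (e x) \<cdot>\<^sub>m Qmat (k x)) * (of_int (e x) \<cdot>\<^sub>m Qmat (k x))) xs)"
    by (rule diag_block_mat_mult) (auto simp: Qmat_def)
  also have "map (\<lambda>x. (of_int (e x) \<cdot>\<^sub>m Qmat (k x)) * (of_int (e x) \<cdot>\<^sub>m Qmat (k x))) xs
     = map (\<lambda>M. 1\<^sub>m (dim_row M)) (map (\<lambda>x. Qmat (k x)) xs)"
    by (simp only: map_map, rule map_cong) (auto simp: smult_Qmat_mult_self[OF assms] carrier_matD[OF Qmat_carrier])
  also have "diag_block_mat \<dots> = 1\<^sub>m (sum_list (map dim_row (map (\<lambda>x. Qmat (k x)) xs)))"
    by (rule diag_block_one_mat)
  also have "map dim_row (map (\<lambda>x. Qmat (k x)) xs) = map k xs" by (auto simp: Qmat_def)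
  finally show ?thesis .
qed

text \<open>If \<open>adj Y * (H * Y)\<close> is this matrix, multiplying by it once more gives the
  identity; this is the explicit left inverse of a canonical basis.\<close>

lemma sip_blocks_mult_self:
  assumes "\<And>k e. (k,e) \<in> set ks \<Longrightarrow> e \<in> {1,-1}"
  shows "sip_blocks ks * sip_blocks ks = 1\<^sub>m (blocks_dim ks)"
  using diag_smult_Qmat_mult_self[of ks snd fst] assms
  by (force simp: sip_blocks_def blocks_dim_def case_prod_unfold)

section \<open>Canonical form of nilpotent selfadjoint matrices\<close>

locale quat_selfadjoint =
  fixes n :: nat and H A :: "complex mat"
  assumes H_Omega: "in_Omega n H" and H_inv: "invertible_mat H" and H_herm: "hermitian H"
    and A_Omega: "in_Omega n A" and A_sa: "H_selfadjoint H A"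
begin

lemma H_carrier [simp, intro]: "H \<in> carrier_mat (2*n) (2*n)"
  and A_carrier [simp, intro]: "A \<in> carrier_mat (2*n) (2*n)"
  using H_Omega A_Omega by (auto intro: in_Omega_carrier)

lemma H_dim [simp]: "dim_row H = 2*n" "dim_col H = 2*n"
  by (rule carrier_matD[OF H_carrier])+

lemma A_dim [simp]: "dim_row A = 2*n" "dim_col A = 2*n"
  by (rule carrier_matD[OF A_carrier])+

lemma A_pow_carrier [simp, intro]: "A ^\<^sub>m p \<in> carrier_mat (2*n) (2*n)"
  by (rule pow_carrier_mat) simp

lemma A_pow_dim [simp]: "dim_row (A ^\<^sub>m p) = 2*n" "dim_col (A ^\<^sub>m p) = 2*n"
  by (rule carrier_matD[OF A_pow_carrier])+

lemma adj_H [simp]: "adj H = H" using H_herm by (simp add: hermitian_def)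

lemma H_A: "H * A = adj A * H" using A_sa by (simp add: H_selfadjoint_def)

lemma A_pow_Omega: "in_Omega n (A ^\<^sub>m p)"
proof (induction p)
  case 0
  have "1\<^sub>m (2*n) * quat_J n = quat_J n * map_mat cnj (1\<^sub>m (2*n))"
  proof -
    have "map_mat cnj (1\<^sub>m (2*n)) = 1\<^sub>m (2*n)" by (rule eq_matI) auto
    then show ?thesis by simp
  qed
  then show ?case by (simp add: in_Omega_iff)
qed (auto intro: in_Omega_mult A_Omega)

lemma H_A_pow: "H * A ^\<^sub>m p = adj (A ^\<^sub>m p) * H"
proof (induction p)
  case 0
  have "adj (1\<^sub>m (2*n)) = 1\<^sub>m (2*n)" by (rule eq_matI) auto
  then show ?case by simp
next
  case (Suc p)
  have comm: "A ^\<^sub>m p * A = A * A ^\<^sub>m p"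
    using pow_mat_add[OF A_carrier, of p 1] pow_mat_add[OF A_carrier, of 1 p] by (simp add: add.commute)
  have "H * A ^\<^sub>m Suc p = H * A * A ^\<^sub>m p" by (simp add: comm mat_assoc)
  also have "\<dots> = adj A * (adj (A ^\<^sub>m p) * H)" by (simp add: H_A mat_assoc Suc)
  also have "\<dots> = adj (A ^\<^sub>m Suc p) * H" by (simp add: adj_mult mat_assoc)
  finally show ?case .
qed

text \<open>One Hermitian form for each exponent. By selfadjointness a power of \<open>A\<close> on
  either argument can be absorbed into the index \<open>p\<close>, so all Gram entries of a chain
  are values of these forms at its generator.\<close>

definition form :: "nat \<Rightarrow> complex vec \<Rightarrow> complex vec \<Rightarrow> complex" where
  "form p u v = ip u (H * A ^\<^sub>m p *\<^sub>v v)"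

lemma form_carrier [simp, intro]: "H * A ^\<^sub>m p \<in> carrier_mat (2*n) (2*n)"
  by (rule mult_carrier_mat) auto

lemma adj_form: "adj (H * A ^\<^sub>m p) = H * A ^\<^sub>m p"
  by (simp add: adj_mult H_A_pow)

abbreviation V where "V \<equiv> carrier_vec (2*n) :: complex vec set"

lemma form_cnj:
  assumes "u \<in> V" "v \<in> V" shows "cnj (form p u v) = form p v u"
proof -
  have "cnj (form p u v) = ip (H * A ^\<^sub>m p *\<^sub>v v) u"
    unfolding form_def using assms by (intro cnj_ip) auto
  also have "\<dots> = form p v u"
    unfolding form_def using ip_mult_mat_vec[OF form_carrier, of v u p] assms by (simp add: adj_form)
  finally show ?thesis .
qed

lemma form_add_right: "u \<in> V \<Longrightarrow> v \<in> V \<Longrightarrow> w \<in> V \<Longrightarrow> form p u (v + w) = form p u v + form p u w"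
  unfolding form_def
  by (subst mult_add_distrib_mat_vec[of _ "2*n" "2*n"], auto, subst ip_add_right[of _ "2*n"])
    (auto intro!: mult_mat_vec_carrier[of _ _ "2*n"])

lemma form_add_left: "u \<in> V \<Longrightarrow> v \<in> V \<Longrightarrow> w \<in> V \<Longrightarrow> form p (u + v) w = form p u w + form p v w"
  unfolding form_def
  by (subst ip_add_left[of _ "2*n"]) (auto intro!: mult_mat_vec_carrier[of _ _ "2*n"])

lemma form_smult_right: "u \<in> V \<Longrightarrow> v \<in> V \<Longrightarrow> form p u (c \<cdot>\<^sub>v v) = c * form p u v"
  unfolding form_def by (subst mult_mat_vec[of _ "2*n" "2*n"]) (auto simp: ip_smult_right)

lemma form_smult_left: "u \<in> V \<Longrightarrow> v \<in> V \<Longrightarrow> form p (c \<cdot>\<^sub>v u) v = cnj c * form p u v"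
  unfolding form_def by (subst ip_smult_left) auto

lemma form_shift_right: "u \<in> V \<Longrightarrow> v \<in> V \<Longrightarrow> form p u (A ^\<^sub>m q *\<^sub>v v) = form (p + q) u v"
  by (simp add: form_def mat_vec_assoc pow_mat_add[OF A_carrier])

lemma A_pow_V [simp, intro]: "v \<in> V \<Longrightarrow> A ^\<^sub>m q *\<^sub>v v \<in> V"
  by (rule mult_mat_vec_carrier) auto

lemma form_shift_left: "u \<in> V \<Longrightarrow> v \<in> V \<Longrightarrow> form p (A ^\<^sub>m q *\<^sub>v u) v = form (p + q) u v"
  by (subst (1 2) form_cnj[symmetric]) (auto simp: form_shift_right)

lemma form_pow_zero:
  assumes "A ^\<^sub>m k *\<^sub>v v = 0\<^sub>v (2*n)" "k \<le> p" "u \<in> V" "v \<in> V"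
  shows "form p u v = 0"
proof -
  have "form p u v = form (p - k) u (A ^\<^sub>m k *\<^sub>v v)" using form_shift_right[of u v "p - k" k] assms by simp
  \<comment> \<open>Writing the zero vector as a multiple with factor 0 lets linearity give the
    value.\<close>
  also have "\<dots> = form (p - k) u (0 \<cdot>\<^sub>v 0\<^sub>v (2*n))"
    using assms by (intro arg_cong[of _ _ "form (p - k) u"]) auto
  also have "\<dots> = 0" using assms by (subst form_smult_right) auto
  finally show ?thesis .
qed

text \<open>Since \<open>quat_J\<close> is real and skew, the pairing of phi(a) with b changes sign
  when a and b are exchanged. The Hermitian matrix \<open>H * A ^\<^sub>m p\<close> can be moved to
  the left factor and then, commuting with phi, inside it; exchanging the arguments shows that the
  value is its own negative.\<close>

lemma form_quat_conj:
  assumes u: "u \<in> V"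
  shows "form p (quat_J n *\<^sub>v map_vec cnj u) u = 0"
proof -
  let ?K = "quat_J n" and ?c = "map_vec cnj" and ?G = "H * A ^\<^sub>m p"
  have G: "?G * ?K = ?K * map_mat cnj ?G"
    using in_Omega_mult[OF H_Omega A_pow_Omega] by (auto simp: in_Omega_iff)
  have d: "dim_vec u = 2*n" using u by auto
  have Gu: "?G *\<^sub>v u \<in> V" using u by (intro mult_mat_vec_carrier[of _ _ "2*n"]) auto
  have K: "ip (?K *\<^sub>v ?c a) b = - ip (?K *\<^sub>v ?c b) a" if ab: "a \<in> V" "b \<in> V" for a b
  proof -
    have "ip (?K *\<^sub>v ?c a) b = ip (?c (?K *\<^sub>v a)) b" using ab by (simp add: map_vec_cnj_mult)
    also have "\<dots> = ip (?c b) (?K *\<^sub>v a)" using ab by (intro ip_cnj_commute) auto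
    also have "\<dots> = ip (adj ?K *\<^sub>v ?c b) a" using ab by (intro ip_mult_mat_vec[of _ "2*n" "2*n"]) auto
    also have "\<dots> = - ip (?K *\<^sub>v ?c b) a" using ab
      by (simp add: adj_quat_J ip_uminus_left)
    finally show ?thesis .
  qed
  have "form p (?K *\<^sub>v ?c u) u = ip (adj ?G *\<^sub>v (?K *\<^sub>v ?c u)) u"
    unfolding form_def using u
    by (intro ip_mult_mat_vec[of _ "2*n" "2*n"]) (auto intro!: mult_mat_vec_carrier[of _ _ "2*n"])
  also have "adj ?G *\<^sub>v (?K *\<^sub>v ?c u) = ?G * ?K *\<^sub>v ?c u"
    unfolding adj_form using d by (intro mat_vec_assoc[symmetric]) auto
  also have "\<dots> = ?K *\<^sub>v ?c (?G *\<^sub>v u)"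
    unfolding G using d by (subst mat_vec_assoc) (auto simp: map_vec_cnj_mult)
  also have "ip \<dots> u = - form p (?K *\<^sub>v ?c u) u"
    unfolding form_def using u Gu by (rule K[rotated])
  finally show ?thesis by simp
qed

text \<open>The value at \<open>u + v\<close> controls the sum of \<open>form p u v\<close> and
  \<open>form p v u\<close>, the value at \<open>u + \<i> \<cdot>\<^sub>v v\<close> their
  difference. With explicit candidates, x is seen to stay in any subspace containing u and
  v.\<close>

lemma polarization:
  assumes uv: "u \<in> V" "v \<in> V" and "form p u v \<noteq> 0"
  shows "\<exists>x \<in> {u, v, u + v, u + \<i> \<cdot>\<^sub>v v}. form p x x \<noteq> 0"
proof (rule ccontr)
  assume "\<not> ?thesis"
  then have z: "form p u u = 0" "form p v v = 0" "form p (u + v) (u + v) = 0"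
    "form p (u + \<i> \<cdot>\<^sub>v v) (u + \<i> \<cdot>\<^sub>v v) = 0" by auto
  have "form p (u + v) (u + v) = form p u v + form p v u"
    using uv z(1,2) by (simp add: form_add_left form_add_right)
  moreover have "form p (u + \<i> \<cdot>\<^sub>v v) (u + \<i> \<cdot>\<^sub>v v) = \<i> * form p u v - \<i> * form p v u"
    using uv z(1,2) by (simp add: form_add_left form_add_right form_smult_left form_smult_right)
  ultimately show False using z assms(3) by (auto simp: algebra_simps)
qed

text \<open>Here \<open>k\<close> is the top exponent, one less than the chain length. The zeros are
  produced downwards from p = k - 1. Adding \<open>b\<close> times \<open>A ^\<^sub>m Suc s\<close>
  of the vector changes the form at p by multiples of the forms at p + s + 1 and p + 2s + 2; for p
  above k - s - 1 these exponents exceed k, so what has been achieved is kept.\<close>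

lemma normalise_chain:
  assumes W: "W \<subseteq> V" and W_add: "\<And>u v. u \<in> W \<Longrightarrow> v \<in> W \<Longrightarrow> u + v \<in> W"
    and W_smult: "\<And>c v. v \<in> W \<Longrightarrow> c \<cdot>\<^sub>v v \<in> W"
    and W_A: "\<And>p v. v \<in> W \<Longrightarrow> A ^\<^sub>m p *\<^sub>v v \<in> W"
    and nil: "\<And>v. v \<in> W \<Longrightarrow> A ^\<^sub>m Suc k *\<^sub>v v = 0\<^sub>v (2*n)"
    and x: "x \<in> W" "form k x x \<noteq> 0"
  obtains y \<epsilon> where "y \<in> W" "\<epsilon> \<in> {1, -1 :: int}"
    "\<And>p. form p y y = (if p = k then of_int \<epsilon> else 0)"
proof -
  have real: "form p v v = of_real (Re (form p v v))" if "v \<in> W" for p v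
    using form_cnj[of v v p] that W by (auto simp: complex_eq_iff)
  define c where "c = Re (form k x x)"
  have c: "form k x x = of_real c" "c \<noteq> 0" using real[OF x(1), of k] x(2) by (auto simp: c_def)
  \<comment> \<open>Scaling multiplies the form by a positive number, so it normalises the modulus
    of \<open>c\<close> but not its sign.\<close>
  define \<epsilon> :: int where "\<epsilon> = (if c > 0 then 1 else -1)"
  have \<epsilon>: "\<epsilon> \<in> {1,-1}" by (simp add: \<epsilon>_def)
  define y where "y = complex_of_real (1 / sqrt \<bar>c\<bar>) \<cdot>\<^sub>v x"
  have yW: "y \<in> W" unfolding y_def using x by (intro W_smult)
  have "form k y y = of_real ((1 / sqrt \<bar>c\<bar>) * ((1 / sqrt \<bar>c\<bar>) * c))"
    unfolding y_def using x W c by (subst form_smult_left, force, force, subst form_smult_right) (auto simp flip: of_real_mult)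
  also have "(1 / sqrt \<bar>c\<bar>) * ((1 / sqrt \<bar>c\<bar>) * c) = c / \<bar>c\<bar>" by simp
  also have "\<dots> = of_int \<epsilon>" using c by (auto simp: \<epsilon>_def)
  finally have yk: "form k y y = of_int \<epsilon>" by simp
  have "s \<le> k \<Longrightarrow> \<exists>y\<in>W. form k y y = of_int \<epsilon> \<and> (\<forall>p. k - s \<le> p \<longrightarrow> p < k \<longrightarrow> form p y y = 0)" for s
  proof (induction s)
    case 0
    then show ?case using yW yk by auto
  next
    case (Suc s)
    then obtain y where y: "y \<in> W" "form k y y = of_int \<epsilon>"
      "\<And>p. k - s \<le> p \<Longrightarrow> p < k \<Longrightarrow> form p y y = 0" by auto
    have yV: "y \<in> V" using y W by auto
    \<comment> \<open>Solves \<open>form p y y + 2 * b * \<epsilon> = 0\<close> at p = k - s - 1,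
      using that the square of \<epsilon> is 1.\<close>
    define b where "b = complex_of_real (- (of_int \<epsilon> * Re (form (k - Suc s) y y) / 2))"
    define z where "z = y + b \<cdot>\<^sub>v (A ^\<^sub>m Suc s *\<^sub>v y)"
    have zW: "z \<in> W" unfolding z_def using y by (intro W_add W_smult W_A)
    have big: "form p y y = 0" if "p > k" for p
      using form_pow_zero[OF nil[OF y(1)], of p y] yV that by auto
    have AV: "A ^\<^sub>m Suc s *\<^sub>v y \<in> V" by (rule A_pow_V[OF yV])
    have expand: "form p z z = form p y y + 2 * b * form (p + Suc s) y y
       + b * b * form (p + Suc s + Suc s) y y" for p
    proof -
      have "form p z z = form p y y + b * form p y (A ^\<^sub>m Suc s *\<^sub>v y) + (cnj b * form p (A ^\<^sub>m Suc s *\<^sub>v y) y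
         + cnj b * (b * form p (A ^\<^sub>m Suc s *\<^sub>v y) (A ^\<^sub>m Suc s *\<^sub>v y)))"
        unfolding z_def using yV AV
        by (simp add: form_add_left form_add_right form_smult_left form_smult_right del: pow_mat.simps)
          (simp add: algebra_simps)
      moreover have "cnj b = b" by (simp add: b_def)
      moreover have "form p y (A ^\<^sub>m Suc s *\<^sub>v y) = form (p + Suc s) y y"
        "form p (A ^\<^sub>m Suc s *\<^sub>v y) y = form (p + Suc s) y y"
        "form p (A ^\<^sub>m Suc s *\<^sub>v y) (A ^\<^sub>m Suc s *\<^sub>v y) = form (p + Suc s + Suc s) y y"
        using form_shift_left[OF yV yV, of p "Suc s"] form_shift_right[OF yV yV, of p "Suc s"]
          form_shift_left[OF yV AV, of p "Suc s"] form_shift_right[OF yV yV, of "p + Suc s" "Suc s"]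
        by simp_all
      ultimately show ?thesis by (simp add: algebra_simps del: pow_mat.simps)
    qed
    have "form p z z = 0" if p: "k - Suc s \<le> p" "p < k" for p
    proof (cases "p = k - Suc s")
      case True
      then have e: "p + Suc s = k" using Suc.prems by simp
      have "form p z z = form p y y + 2 * b * of_int \<epsilon>" unfolding expand e by (simp add: y big)
      moreover have "form p y y = of_real (Re (form p y y))" using real[OF y(1)] .
      moreover have "2 * b * of_int \<epsilon> = - of_real (Re (form p y y))"
        using \<epsilon> unfolding b_def True by auto
      ultimately show ?thesis by simp
    next
      case False
      then show ?thesis using p y(3)[of p] by (simp add: expand big)
    qed
    moreover have "form k z z = of_int \<epsilon>" by (simp add: expand big y)
    ultimately show ?case using zW by blast
  qed
  from this[of k] obtain y where y: "y \<in> W" "form k y y = of_int \<epsilon>" "\<And>p. p < k \<Longrightarrow> form p y y = 0" by auto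
  have "form p y y = (if p = k then of_int \<epsilon> else 0)" for p
    using y form_pow_zero[OF nil[OF y(1)], of p y] W by (cases p k rule: linorder_cases) auto
  with y(1) \<epsilon> show ?thesis using that by blast
qed

end

section \<open>Matrix identities for shifts, orthogonality and the map phi\<close>

lemma mult_jordan_block_index:
  assumes "X \<in> carrier_mat r k" "i < r" "j < k"
  shows "(X * jordan_block k (0::complex)) $$ (i,j) = (if j = 0 then 0 else X $$ (i, j - 1))"
proof -
  have "(X * jordan_block k (0::complex)) $$ (i,j) = (\<Sum>l = 0..<k. X $$ (i,l) * (if Suc l = j then 1 else 0))"
    using assms by (auto simp: jordan_block_def scalar_prod_def intro!: sum.cong)
  also have "\<dots> = (if j = 0 then 0 else X $$ (i, j - 1))"
  proof (cases j)
    case (Suc j')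
    then show ?thesis using assms by (simp add: if_distrib[of "\<lambda>x. _ * x"] cong: if_cong)
  qed auto
  finally show ?thesis .
qed

lemma adj_hcat_mult_zero:
  assumes "adj (hcat X Y) * Z = 0\<^sub>m (dim_col X + dim_col Y) c" "dim_row Y = dim_row X" "dim_row Z = dim_row X"
  shows "adj X * Z = 0\<^sub>m (dim_col X) c" "adj Y * Z = 0\<^sub>m (dim_col Y) c"
proof -
  have c: "dim_col Z = c" using arg_cong[OF assms(1), of dim_col] by simp
  have e: "(adj (hcat X Y) * Z) $$ (i,j) = 0" if "i < dim_col X + dim_col Y" "j < c" for i j
    using that assms(1) by simp
  show "adj X * Z = 0\<^sub>m (dim_col X) c"
  proof (rule eq_matI)
    fix i j assume "i < dim_row (0\<^sub>m (dim_col X) c :: complex mat)" "j < dim_col (0\<^sub>m (dim_col X) c :: complex mat)"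
    then show "(adj X * Z) $$ (i,j) = 0\<^sub>m (dim_col X) c $$ (i,j)"
      using e[of i j] assms(2,3) c by (auto simp: scalar_prod_def)
  qed (use c in auto)
  show "adj Y * Z = 0\<^sub>m (dim_col Y) c"
  proof (rule eq_matI)
    fix i j assume "i < dim_row (0\<^sub>m (dim_col Y) c :: complex mat)" "j < dim_col (0\<^sub>m (dim_col Y) c :: complex mat)"
    then show "(adj Y * Z) $$ (i,j) = 0\<^sub>m (dim_col Y) c $$ (i,j)"
      using e[of "dim_col X + i" j] assms(2,3) c by (auto simp: scalar_prod_def)
  qed (use c in auto)
qed

lemma col_quat_conj:
  assumes "Y \<in> carrier_mat (2*n) c" "j < c"
  shows "col (quat_conj n Y) j = quat_J n *\<^sub>v map_vec cnj (col Y j)"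
  using assms by (intro eq_vecI) (auto simp: quat_conj_def scalar_prod_def)

lemma quat_J_mult_self: "quat_J n * quat_J n = - 1\<^sub>m (2*n)"
proof -
  have "quat_J n * quat_J n = four_block_mat (- 1\<^sub>m n) (0\<^sub>m n n) (0\<^sub>m n n) (- 1\<^sub>m n)"
    unfolding quat_J_def
    by (subst mult_four_block_mat[of _ n n _ n _ n]) (auto intro!: cong_four_block_mat eq_matI)
  then show ?thesis by (auto intro!: eq_matI)
qed

lemma adj_quat_J_mult: "adj (quat_J n) * quat_J n = 1\<^sub>m (2*n)"
  by (simp add: adj_quat_J quat_J_mult_self)

lemma diag_block_mat_pair_mult:
  assumes "A \<in> carrier_mat N N" "B \<in> carrier_mat N N" "C \<in> carrier_mat N N" "D \<in> carrier_mat N N"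
  shows "diag_block_mat [A,B] * diag_block_mat [C,D] = diag_block_mat [A * C, B * D]"
  using assms unfolding diag_block_mat_pair
  by (subst mult_four_block_mat[of _ N N _ N _ N]) auto

lemma diag_block_mat_pair_one: "diag_block_mat [1\<^sub>m N, 1\<^sub>m N] = (1\<^sub>m (N + N) :: complex mat)"
  unfolding diag_block_mat_pair by simp

lemma diag_block_mat_pair_carrier:
  assumes "A \<in> carrier_mat a b" "B \<in> carrier_mat c d"
  shows "diag_block_mat [A,B] \<in> carrier_mat (a + c) (b + d)"
  using assms unfolding diag_block_mat_pair by auto

lemma mult_quat_conj:
  assumes "in_Omega n M" "dim_row Y = 2*n"
  shows "M * quat_conj n Y = quat_conj n (M * Y)"
proof -
  have M: "M \<in> carrier_mat (2*n) (2*n)" "M * quat_J n = quat_J n * map_mat cnj M"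
    using assms by (auto simp: in_Omega_iff)
  have "M * quat_conj n Y = M * quat_J n * map_mat cnj Y"
    unfolding quat_conj_def using M(1) assms by (subst mat_assoc) auto
  also have "\<dots> = quat_conj n (M * Y)"
    unfolding quat_conj_def M(2) using M(1) assms by (simp add: cnj_mat_mult mat_assoc)
  finally show ?thesis .
qed

text \<open>\<open>quat_J\<close> is unitary, so only the conjugation in phi affects a Gram
  matrix.\<close>

lemma adj_quat_conj_mult_quat_conj:
  assumes "dim_row X = 2*n" "dim_row Y = 2*n"
  shows "adj (quat_conj n X) * quat_conj n Y = map_mat cnj (adj X * Y)"
proof -
  have "adj (quat_conj n X) * quat_conj n Y
     = adj (map_mat cnj X) * (adj (quat_J n) * quat_J n * map_mat cnj Y)"
    unfolding quat_conj_def using assms by (simp add: adj_mult mat_assoc)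
  also have "\<dots> = adj (map_mat cnj X) * map_mat cnj Y"
    unfolding adj_quat_J_mult using assms by (simp add: left_mult_one_mat')
  finally show ?thesis using assms by (simp add: adj_cnj_mat cnj_mat_mult)
qed

lemma quat_conj_quat_conj: "dim_row Y = 2*n \<Longrightarrow> quat_conj n (quat_conj n Y) = - Y"
proof -
  assume Y: "dim_row Y = 2*n"
  have "quat_conj n (quat_conj n Y) = quat_J n * quat_J n * Y"
    using Y by (simp add: quat_conj_def cnj_mat_mult mat_assoc)
  then show ?thesis using Y by (simp add: quat_J_mult_self left_mult_one_mat')
qed

section \<open>Building a canonical basis chain by chain\<close>

context quat_selfadjoint
begin

text \<open>Half of a partial canonical basis: chains in canonical position that are also
  H-orthogonal to all their images under phi. The other half is \<open>quat_conj n Y\<close> and is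
  left implicit, so that \<open>ks\<close> records each doubled block once.\<close>

definition frame :: "complex mat \<Rightarrow> (nat \<times> int) list \<Rightarrow> bool" where
  "frame Y ks \<longleftrightarrow> Y \<in> carrier_mat (2*n) (blocks_dim ks) \<and>
     (\<forall>(k,e) \<in> set ks. 0 < k \<and> e \<in> {1,-1}) \<and>
     A * Y = Y * jordan_blocks ks \<and> adj Y * (H * Y) = sip_blocks ks \<and>
     adj (quat_conj n Y) * (H * Y) = 0\<^sub>m (blocks_dim ks) (blocks_dim ks)"

text \<open>Apply phi to both factors of the hypothesis: this conjugates the product, and phi
  applied twice is minus the identity.\<close>

lemma adj_mult_quat_conj_zero:
  assumes "adj (quat_conj n Y) * (H * X) = 0\<^sub>m (dim_col Y) (dim_col X)" "dim_row X = 2*n" "dim_row Y = 2*n"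
  shows "adj Y * (H * quat_conj n X) = 0\<^sub>m (dim_col Y) (dim_col X)"
proof -
  have "map_mat cnj (adj (quat_conj n Y) * (H * X)) = adj (quat_conj n (quat_conj n Y)) * quat_conj n (H * X)"
    using assms by (subst adj_quat_conj_mult_quat_conj) auto
  also have "\<dots> = - (adj Y * (H * quat_conj n X))"
  proof -
    have "adj (- Y) = - adj Y" by (rule eq_matI) auto
    then show ?thesis using assms by (simp add: quat_conj_quat_conj mult_quat_conj[OF H_Omega])
  qed
  finally have "- (adj Y * (H * quat_conj n X)) = map_mat cnj (0\<^sub>m (dim_col Y) (dim_col X))"
    unfolding assms(1) by simp
  then have "adj Y * (H * quat_conj n X) = - map_mat cnj (0\<^sub>m (dim_col Y) (dim_col X))"
    by (metis uminus_uminus_mat)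
  then show ?thesis by (auto intro!: eq_matI)
qed

lemma adj_quat_conj_mult_zero:
  assumes "adj (quat_conj n Y) * (H * X) = 0\<^sub>m (dim_col Y) (dim_col X)" "dim_row X = 2*n" "dim_row Y = 2*n"
  shows "adj (quat_conj n X) * (H * Y) = 0\<^sub>m (dim_col X) (dim_col Y)"
proof -
  have "adj (adj Y * (H * quat_conj n X)) = adj (quat_conj n X) * (H * Y)"
    using assms by (simp add: adj_mult mat_assoc)
  then show ?thesis using adj_mult_quat_conj_zero[OF assms] by simp
qed

text \<open>phi commutes with \<open>A\<close> and \<open>H\<close>, and the canonical matrices are
  real, so the images form a second copy of the same structure. The last clause exhibits a left
  inverse of \<open>S\<close>.\<close>

lemma frame_double:
  assumes "frame Y ks"
  defines "S \<equiv> hcat Y (quat_conj n Y)"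
  shows "S \<in> carrier_mat (2*n) (2 * blocks_dim ks)"
    and "A * S = S * diag_block_mat [jordan_blocks ks, jordan_blocks ks]"
    and "adj S * (H * S) = diag_block_mat [sip_blocks ks, sip_blocks ks]"
    and "diag_block_mat [sip_blocks ks, sip_blocks ks] * (adj S * (H * S)) = 1\<^sub>m (2 * blocks_dim ks)"
proof -
  let ?N = "blocks_dim ks"
  have Y: "Y \<in> carrier_mat (2*n) ?N" and AY: "A * Y = Y * jordan_blocks ks"
    and YHY: "adj Y * (H * Y) = sip_blocks ks"
    and qYHY: "adj (quat_conj n Y) * (H * Y) = 0\<^sub>m ?N ?N"
    and e: "\<And>k e. (k,e) \<in> set ks \<Longrightarrow> e \<in> {1,-1}"
    using assms by (auto simp: frame_def)
  have [simp]: "dim_row Y = 2*n" "dim_col Y = ?N" using Y by auto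
  show S: "S \<in> carrier_mat (2*n) (2 * ?N)" unfolding S_def mult_2[of ?N] using Y by auto
  have "A * quat_conj n Y = quat_conj n Y * jordan_blocks ks"
    unfolding mult_quat_conj[OF A_Omega \<open>dim_row Y = 2*n\<close>] AY
    by (simp add: quat_conj_def cnj_mat_mult mat_assoc)
  then show "A * S = S * diag_block_mat [jordan_blocks ks, jordan_blocks ks]"
    unfolding S_def diag_block_mat_pair blocks_dims
    by (subst hcat_mult_diag[of _ "2*n" ?N _ ?N _ ?N _ ?N]) (use Y in \<open>auto simp: mult_hcat AY\<close>)
  have "adj Y * (H * quat_conj n Y) = 0\<^sub>m ?N ?N"
    using adj_mult_quat_conj_zero[of Y Y] qYHY by simp
  moreover have "adj (quat_conj n Y) * (H * quat_conj n Y) = sip_blocks ks"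
    by (simp add: mult_quat_conj[OF H_Omega] adj_quat_conj_mult_quat_conj YHY)
  ultimately show g: "adj S * (H * S) = diag_block_mat [sip_blocks ks, sip_blocks ks]"
    unfolding S_def diag_block_mat_pair blocks_dims
    by (subst mult_hcat, simp, simp, subst adj_hcat_mult_hcat) (auto simp: YHY qYHY)
  show "diag_block_mat [sip_blocks ks, sip_blocks ks] * (adj S * (H * S)) = 1\<^sub>m (2 * ?N)"
    unfolding g using sip_blocks_mult_self[OF e]
    by (subst diag_block_mat_pair_mult[of _ ?N]) (auto simp only: diag_block_mat_pair_one mult_2 sip_blocks_carrier)
qed

lemma frame_dim_le:
  assumes f: "frame Y ks"
  shows "blocks_dim ks \<le> n"
proof -
  let ?N = "blocks_dim ks"
  define S G where "S = hcat Y (quat_conj n Y)" and "G = diag_block_mat [sip_blocks ks, sip_blocks ks]"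
  have S: "S \<in> carrier_mat (2*n) (2 * ?N)" unfolding S_def by (rule frame_double(1)[OF f])
  have G: "G \<in> carrier_mat (2 * ?N) (2 * ?N)"
    unfolding mult_2 G_def by (rule diag_block_mat_pair_carrier) auto
  have "G * (adj S * H) * S = 1\<^sub>m (2 * ?N)"
    using frame_double(4)[OF f] S G unfolding S_def[symmetric] G_def[symmetric] by (simp add: mat_assoc)
  moreover have "G * (adj S * H) \<in> carrier_mat (2 * ?N) (2*n)" using S G by auto
  ultimately have "2 * ?N \<le> 2 * n" using left_inverse_dim_le[OF S] by blast
  then show ?thesis by simp
qed

text \<open>The highest power comes first: \<open>A\<close> then maps each column to its left
  neighbour and, at the end of the chain, kills the first, matching right multiplication by a Jordan
  block with ones above the diagonal.\<close>

definition chain_mat :: "nat \<Rightarrow> complex vec \<Rightarrow> complex mat" where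
  "chain_mat k x = mat (2*n) k (\<lambda>(i,j). (A ^\<^sub>m (k - 1 - j) *\<^sub>v x) $ i)"

lemma chain_mat_carrier [simp, intro]: "chain_mat k x \<in> carrier_mat (2*n) k"
  by (simp add: chain_mat_def)

lemmas chain_mat_dim [simp] = carrier_matD[OF chain_mat_carrier]

lemma col_chain_mat: "x \<in> V \<Longrightarrow> j < k \<Longrightarrow> col (chain_mat k x) j = A ^\<^sub>m (k - 1 - j) *\<^sub>v x"
  by (rule eq_vecI) (auto simp: chain_mat_def)

lemma A_mult_A_pow: "x \<in> V \<Longrightarrow> A *\<^sub>v (A ^\<^sub>m p *\<^sub>v x) = A ^\<^sub>m Suc p *\<^sub>v x"
proof -
  assume x: "x \<in> V"
  have "A * A ^\<^sub>m p = A ^\<^sub>m Suc p" using pow_mat_add[OF A_carrier, of 1 p] by simp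
  then show ?thesis using mat_vec_assoc[of A "A ^\<^sub>m p" x] x by (simp del: pow_mat.simps)
qed

lemma A_mult_chain_mat:
  assumes x: "x \<in> V" and nil: "A ^\<^sub>m k *\<^sub>v x = 0\<^sub>v (2*n)"
  shows "A * chain_mat k x = chain_mat k x * jordan_block k 0"
proof (rule eq_matI)
  fix i j assume "i < dim_row (chain_mat k x * jordan_block k 0)" "j < dim_col (chain_mat k x * jordan_block k (0::complex))"
  then have ij: "i < 2*n" "j < k" by auto
  have "(A * chain_mat k x) $$ (i,j) = (A *\<^sub>v col (chain_mat k x) j) $ i" using ij by simp
  also have "\<dots> = (A ^\<^sub>m Suc (k - 1 - j) *\<^sub>v x) $ i"
    unfolding col_chain_mat[OF x ij(2)] A_mult_A_pow[OF x] ..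
  also have "\<dots> = (if j = 0 then 0 else chain_mat k x $$ (i, j - 1))"
  proof (cases "j = 0")
    case True
    then have "Suc (k - 1 - j) = k" using ij by simp
    then show ?thesis using True nil ij by simp
  next
    case False
    then have "Suc (k - 1 - j) = k - 1 - (j - 1)" using ij by simp
    then show ?thesis using False ij by (simp add: chain_mat_def del: pow_mat.simps)
  qed
  finally show "(A * chain_mat k x) $$ (i,j) = (chain_mat k x * jordan_block k 0) $$ (i,j)"
    unfolding mult_jordan_block_index[OF chain_mat_carrier ij] .
qed auto

text \<open>Entry (i,j) is the form at exponent (k-1-i) + (k-1-j), which equals k-1 exactly on the
  anti-diagonal i + j = k-1.\<close>

lemma gram_chain_mat:
  assumes x: "x \<in> V" and f: "\<And>p. form p x x = (if p = k - 1 then of_int \<epsilon> else 0)"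
  shows "adj (chain_mat k x) * (H * chain_mat k x) = of_int \<epsilon> \<cdot>\<^sub>m Qmat k"
proof (rule eq_matI)
  fix i j assume "i < dim_row (of_int \<epsilon> \<cdot>\<^sub>m Qmat k)" "j < dim_col (of_int \<epsilon> \<cdot>\<^sub>m Qmat k)"
  then have ij: "i < k" "j < k" by (auto simp: Qmat_def)
  have "(adj (chain_mat k x) * (H * chain_mat k x)) $$ (i,j)
     = ip (A ^\<^sub>m (k - 1 - i) *\<^sub>v x) (H *\<^sub>v (A ^\<^sub>m (k - 1 - j) *\<^sub>v x))"
    using ij by (subst adj_mult_index) (auto simp: col_chain_mat[OF x] col_mult2[of _ "2*n" "2*n" _ k])
  also have "\<dots> = form (k - 1 - j) (A ^\<^sub>m (k - 1 - i) *\<^sub>v x) x"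
    using x by (simp add: form_def mat_vec_assoc)
  also have "\<dots> = form (k - 1 - j + (k - 1 - i)) x x" by (rule form_shift_left[OF x x])
  also have "\<dots> = (of_int \<epsilon> \<cdot>\<^sub>m Qmat k) $$ (i,j)"
  proof -
    have "k - 1 - j + (k - 1 - i) = k - 1 \<longleftrightarrow> i + j = k - 1" using ij by auto
    then show ?thesis using ij unfolding f by (auto simp: Qmat_def)
  qed
  finally show "(adj (chain_mat k x) * (H * chain_mat k x)) $$ (i,j) = (of_int \<epsilon> \<cdot>\<^sub>m Qmat k) $$ (i,j)" .
qed (auto simp: Qmat_def)

text \<open>As \<open>A\<close> commutes with phi, the images of the chain form the chain of phi(x),
  so every entry is a form between phi(x) and x and vanishes by
  \<open>form_quat_conj\<close>.\<close>

lemma quat_gram_chain_mat: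
  assumes x: "x \<in> V"
  shows "adj (quat_conj n (chain_mat k x)) * (H * chain_mat k x) = 0\<^sub>m k k"
proof (rule eq_matI)
  fix i j assume "i < dim_row (0\<^sub>m k k :: complex mat)" "j < dim_col (0\<^sub>m k k :: complex mat)"
  then have ij: "i < k" "j < k" by auto
  let ?y = "quat_J n *\<^sub>v map_vec cnj x" and ?p = "k - 1 - i"
  have y: "?y \<in> V" using x by (intro mult_mat_vec_carrier[of _ _ "2*n"]) auto
  have "quat_J n *\<^sub>v map_vec cnj (A ^\<^sub>m ?p *\<^sub>v x) = quat_J n * map_mat cnj (A ^\<^sub>m ?p) *\<^sub>v map_vec cnj x"
    using x by (simp add: map_vec_cnj_mult mat_vec_assoc)
  also have "quat_J n * map_mat cnj (A ^\<^sub>m ?p) = A ^\<^sub>m ?p * quat_J n"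
    using A_pow_Omega[of ?p] by (auto simp: in_Omega_iff)
  also have "A ^\<^sub>m ?p * quat_J n *\<^sub>v map_vec cnj x = A ^\<^sub>m ?p *\<^sub>v ?y" using x by (simp add: mat_vec_assoc)
  finally have c: "col (quat_conj n (chain_mat k x)) i = A ^\<^sub>m ?p *\<^sub>v ?y"
    using ij x by (simp add: col_quat_conj[of _ _ k] col_chain_mat)
  have "(adj (quat_conj n (chain_mat k x)) * (H * chain_mat k x)) $$ (i,j)
     = ip (A ^\<^sub>m ?p *\<^sub>v ?y) (H *\<^sub>v (A ^\<^sub>m (k - 1 - j) *\<^sub>v x))"
    using ij by (subst adj_mult_index) (auto simp: c col_chain_mat[OF x] col_mult2[of _ "2*n" "2*n" _ k])
  also have "\<dots> = form (k - 1 - j) (A ^\<^sub>m ?p *\<^sub>v ?y) x"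
    using x by (simp add: form_def mat_vec_assoc)
  also have "\<dots> = form (k - 1 - j + ?p) ?y x" by (rule form_shift_left[OF y x])
  also have "\<dots> = 0" by (rule form_quat_conj[OF x])
  finally show "(adj (quat_conj n (chain_mat k x)) * (H * chain_mat k x)) $$ (i,j) = 0\<^sub>m k k $$ (i,j)"
    using ij by simp
qed auto

text \<open>Orthogonality of the new chain to \<open>Y\<close> and its image is the hypothesis
  \<open>orth\<close>; the remaining off-diagonal blocks follow by taking adjoints and applying
  phi.\<close>

lemma frame_Cons:
  assumes f: "frame Y ks" and k: "0 < k" and \<epsilon>: "\<epsilon> \<in> {1,-1}" and x: "x \<in> V"
    and nil: "A ^\<^sub>m k *\<^sub>v x = 0\<^sub>v (2*n)"
    and fx: "\<And>p. form p x x = (if p = k - 1 then of_int \<epsilon> else 0)"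
    and orth: "\<And>p. adj (hcat Y (quat_conj n Y)) * H *\<^sub>v (A ^\<^sub>m p *\<^sub>v x) = 0\<^sub>v (2 * blocks_dim ks)"
  shows "frame (hcat (chain_mat k x) Y) ((k,\<epsilon>) # ks)"
proof -
  let ?N = "blocks_dim ks" and ?X = "chain_mat k x" and ?S = "hcat Y (quat_conj n Y)"
  have Y: "Y \<in> carrier_mat (2*n) ?N" and AY: "A * Y = Y * jordan_blocks ks"
    and YHY: "adj Y * (H * Y) = sip_blocks ks"
    and qYHY: "adj (quat_conj n Y) * (H * Y) = 0\<^sub>m ?N ?N"
    and e: "\<forall>(k,e) \<in> set ks. 0 < k \<and> e \<in> {1,-1}"
    using f by (auto simp: frame_def)
  have [simp]: "dim_row Y = 2*n" "dim_col Y = ?N" using Y by auto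
  have S: "?S \<in> carrier_mat (2*n) (2 * ?N)" by (rule frame_double(1)[OF f])
  have "adj ?S * H * ?X = 0\<^sub>m (2 * ?N) k"
  proof (rule mat_col_eqI)
    fix j assume "j < dim_col (0\<^sub>m (2 * ?N) k :: complex mat)"
    then have j: "j < k" by simp
    have "col (adj ?S * H * ?X) j = adj ?S * H *\<^sub>v col ?X j"
      using S j by (intro col_mult2[of _ "2 * ?N" "2*n" _ k]) auto
    then show "col (adj ?S * H * ?X) j = col (0\<^sub>m (2 * ?N) k) j"
      unfolding col_chain_mat[OF x j] orth using j by simp
  qed auto
  then have "adj ?S * (H * ?X) = 0\<^sub>m (dim_col Y + dim_col (quat_conj n Y)) k"
    by (subst mat_assoc[symmetric]) (auto simp: mult_2)
  from adj_hcat_mult_zero[OF this]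
  have YHX: "adj Y * (H * ?X) = 0\<^sub>m ?N k" and qYHX: "adj (quat_conj n Y) * (H * ?X) = 0\<^sub>m ?N k" by auto
  have XHY: "adj ?X * (H * Y) = 0\<^sub>m k ?N"
  proof -
    have "adj (adj Y * (H * ?X)) = adj ?X * (H * Y)" by (simp add: adj_mult mat_assoc)
    then show ?thesis by (simp add: YHX)
  qed
  have qXHY: "adj (quat_conj n ?X) * (H * Y) = 0\<^sub>m k ?N"
    using adj_quat_conj_mult_zero[of Y ?X] qYHX by simp
  have dim: "blocks_dim ((k,\<epsilon>) # ks) = k + ?N" by (simp add: blocks_dim_def)
  have J: "jordan_blocks ((k,\<epsilon>) # ks) = four_block_mat (jordan_block k 0) (0\<^sub>m k ?N) (0\<^sub>m ?N k) (jordan_blocks ks)"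
    using jordan_blocks_carrier[of ks] unfolding jordan_blocks_def list.map split
    by (subst diag_block_mat_Cons[of _ k k _ ?N ?N]) auto
  have Q: "sip_blocks ((k,\<epsilon>) # ks) = four_block_mat (of_int \<epsilon> \<cdot>\<^sub>m Qmat k) (0\<^sub>m k ?N) (0\<^sub>m ?N k) (sip_blocks ks)"
    using sip_blocks_carrier[of ks] unfolding sip_blocks_def list.map split
    by (subst diag_block_mat_Cons[of _ k k _ ?N ?N]) auto
  have "hcat ?X Y \<in> carrier_mat (2*n) (k + ?N)" using Y by auto
  moreover have "A * hcat ?X Y = hcat ?X Y * jordan_blocks ((k,\<epsilon>) # ks)"
    unfolding J using Y
    by (subst hcat_mult_diag[of _ "2*n" k _ ?N _ k _ ?N]) (auto simp: mult_hcat AY A_mult_chain_mat[OF x nil])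
  moreover have "adj (hcat ?X Y) * (H * hcat ?X Y) = sip_blocks ((k,\<epsilon>) # ks)"
    unfolding Q
    by (subst mult_hcat, simp, simp, subst adj_hcat_mult_hcat) (auto simp: XHY YHX YHY gram_chain_mat[OF x fx])
  moreover have "adj (quat_conj n (hcat ?X Y)) * (H * hcat ?X Y) = 0\<^sub>m (k + ?N) (k + ?N)"
    by (subst quat_conj_hcat, simp, simp, subst mult_hcat, simp, simp, subst adj_hcat_mult_hcat)
      (auto simp: qXHY qYHX qYHY quat_gram_chain_mat[OF x])
  ultimately show ?thesis unfolding frame_def dim using e k \<epsilon> by auto
qed

text \<open>W is the H-orthogonal complement of the frame and its images. It is
  \<open>A\<close>-invariant and nonzero, and H is nondegenerate on it, so the end of a longest
  chain in W has a partner in W, and polarization yields a generator with nonzero top form.\<close>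

lemma frame_extend:
  assumes f: "frame Y ks" and ne: "blocks_dim ks \<noteq> n" and nilp: "A ^\<^sub>m K = 0\<^sub>m (2*n) (2*n)"
  obtains Y' k e where "frame Y' ((k,e) # ks)" "0 < k"
proof -
  let ?N = "blocks_dim ks" and ?S = "hcat Y (quat_conj n Y)"
  let ?G = "diag_block_mat [sip_blocks ks, sip_blocks ks]"
  let ?J = "diag_block_mat [jordan_blocks ks, jordan_blocks ks]"
  define S G J where "S = ?S" and "G = ?G" and "J = ?J"
  have S: "S \<in> carrier_mat (2*n) (2 * ?N)" unfolding S_def by (rule frame_double(1)[OF f])
  have G: "G \<in> carrier_mat (2 * ?N) (2 * ?N)" unfolding mult_2 G_def by (rule diag_block_mat_pair_carrier) auto
  have J: "J \<in> carrier_mat (2 * ?N) (2 * ?N)" unfolding mult_2 J_def by (rule diag_block_mat_pair_carrier) auto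
  have AS: "A * S = S * J" unfolding S_def J_def by (rule frame_double(2)[OF f])
  have gram: "adj S * (H * S) = G" unfolding S_def G_def by (rule frame_double(3)[OF f])
  have GG: "G * G = 1\<^sub>m (2 * ?N)" using frame_double(3,4)[OF f] unfolding S_def G_def by simp
  note dims [simp] = carrier_matD[OF S] carrier_matD[OF G] carrier_matD[OF J]
  define W where "W = {w \<in> V. adj S * H *\<^sub>v w = 0\<^sub>v (2 * ?N)}"
  have SH: "adj S * H \<in> carrier_mat (2 * ?N) (2*n)" using S by auto
  have WV: "W \<subseteq> V" by (auto simp: W_def)
  have W_add: "u + v \<in> W" if "u \<in> W" "v \<in> W" for u v
    using that mult_add_distrib_mat_vec[OF SH, of u v] by (auto simp: W_def)
  have W_smult: "c \<cdot>\<^sub>v v \<in> W" if "v \<in> W" for c v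
    using that mult_mat_vec[OF SH, of v c] by (auto simp: W_def)
  \<comment> \<open>Selfadjointness turns invariance of the span of \<open>S\<close> into invariance
    of its H-orthogonal complement.\<close>
  have SHA: "adj S * H * A = adj J * (adj S * H)"
  proof -
    have "adj S * H * A = adj S * adj A * H" by (simp add: mat_assoc H_A)
    also have "adj S * adj A = adj (A * S)" by (simp add: adj_mult)
    also have "\<dots> = adj J * adj S" by (simp add: AS adj_mult)
    finally show ?thesis by (simp add: mat_assoc)
  qed
  have W_A1: "A *\<^sub>v v \<in> W" if "v \<in> W" for v
  proof -
    have v: "v \<in> V" "adj S * H *\<^sub>v v = 0\<^sub>v (2 * ?N)" using that by (auto simp: W_def)
    have "adj S * H *\<^sub>v (A *\<^sub>v v) = adj S * H * A *\<^sub>v v" using v by (intro mat_vec_assoc[symmetric]) auto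
    also have "\<dots> = adj J *\<^sub>v (adj S * H *\<^sub>v v)" unfolding SHA using v by (intro mat_vec_assoc) auto
    also have "\<dots> = 0\<^sub>v (2 * ?N)" unfolding v(2) by (intro eq_vecI) (auto simp: scalar_prod_def)
    finally show ?thesis using v mult_mat_vec_carrier[OF A_carrier] by (auto simp: W_def)
  qed
  have W_A: "A ^\<^sub>m p *\<^sub>v v \<in> W" if "v \<in> W" for p v
    using that
  proof (induction p)
    case (Suc p)
    then show ?case using W_A1[of "A ^\<^sub>m p *\<^sub>v v"] A_mult_A_pow[of v p] WV by (auto simp del: pow_mat.simps)
  qed (use WV in auto)
  \<comment> \<open>The H-orthogonal projection onto the column space of \<open>S\<close>; the
    factor \<open>G\<close> stands for the inverse of the Gram matrix, which is \<open>G\<close>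
    itself.\<close>
  define P where "P = S * (G * (adj S * H))"
  have P: "P \<in> carrier_mat (2*n) (2*n)" unfolding P_def using S G by auto
  have SHP: "adj S * H * P = adj S * H"
  proof -
    have "adj S * H * P = adj S * (H * S) * (G * (adj S * H))" unfolding P_def by (simp add: mat_assoc)
    also have "\<dots> = G * G * (adj S * H)" unfolding gram by (simp add: mat_assoc)
    finally show ?thesis unfolding GG using SH by simp
  qed
  have proj: "v - P *\<^sub>v v \<in> W" if v: "v \<in> V" for v
  proof -
    have Pv: "P *\<^sub>v v \<in> V" by (rule mult_mat_vec_carrier[OF P v])
    have "adj S * H *\<^sub>v (v - P *\<^sub>v v) = adj S * H *\<^sub>v v - adj S * H *\<^sub>v (P *\<^sub>v v)"
      using mult_minus_distrib_mat_vec[OF SH v Pv] .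
    also have "adj S * H *\<^sub>v (P *\<^sub>v v) = adj S * H * P *\<^sub>v v"
      using v P by (intro mat_vec_assoc[symmetric]) auto
    finally show ?thesis unfolding SHP W_def using v Pv SH by auto
  qed
  \<comment> \<open>Otherwise \<open>S\<close> has a right inverse, so it has at least 2n columns
    and the frame is complete.\<close>
  have "\<exists>v\<in>V. P *\<^sub>v v \<noteq> v"
  proof (rule ccontr)
    assume "\<not> ?thesis"
    then have "P *\<^sub>v v = v" if "v \<in> V" for v using that by auto
    note fixed = this
    have "P * 1\<^sub>m (2*n) = 1\<^sub>m (2*n)"
    proof (rule mat_col_eqI)
      fix j assume "j < dim_col (1\<^sub>m (2*n) :: complex mat)"
      then show "col (P * 1\<^sub>m (2*n)) j = col (1\<^sub>m (2*n)) j"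
        using col_mult2[OF P one_carrier_mat, of j] by (simp add: fixed)
    qed (use P in auto)
    then have "P = 1\<^sub>m (2*n)" using P by simp
    then have "2*n \<le> 2 * ?N"
      using left_inverse_dim_le[of "G * (adj S * H)" "2 * ?N" "2*n" S] S G SH by (auto simp: P_def)
    then show False using frame_dim_le[OF f] ne by simp
  qed
  then obtain v where v: "v \<in> V" "P *\<^sub>v v \<noteq> v" by auto
  define w0 where "w0 = v - P *\<^sub>v v"
  have w0: "w0 \<in> W" unfolding w0_def by (rule proj[OF v(1)])
  have w0_ne: "w0 \<noteq> 0\<^sub>v (2*n)"
  proof
    assume z: "w0 = 0\<^sub>v (2*n)"
    have "P *\<^sub>v v = v"
    proof (rule eq_vecI)
      fix i assume "i < dim_vec v"
      then show "(P *\<^sub>v v) $ i = v $ i" using arg_cong[OF z, of "\<lambda>u. u $ i"] v P unfolding w0_def by auto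
    qed (use v P in auto)
    with v show False by simp
  qed
  \<comment> \<open>The nilpotency index of \<open>A\<close> on W rather than on the whole space:
    the generator found below may be any vector of W, and all of them are killed by
    \<open>A ^\<^sub>m k\<close>.\<close>
  define k where "k = (LEAST k. \<forall>w\<in>W. A ^\<^sub>m k *\<^sub>v w = 0\<^sub>v (2*n))"
  have "\<forall>w\<in>W. A ^\<^sub>m K *\<^sub>v w = 0\<^sub>v (2*n)"
  proof
    fix w assume "w \<in> W"
    then have "w \<in> V" using WV by blast
    then show "A ^\<^sub>m K *\<^sub>v w = 0\<^sub>v (2*n)" unfolding nilp
      by (intro eq_vecI) (auto simp: scalar_prod_def)
  qed
  then have kill: "\<And>w. w \<in> W \<Longrightarrow> A ^\<^sub>m k *\<^sub>v w = 0\<^sub>v (2*n)"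
    unfolding k_def using LeastI[of "\<lambda>k. \<forall>w\<in>W. A ^\<^sub>m k *\<^sub>v w = 0\<^sub>v (2*n)"] by blast
  have "k \<noteq> 0" using kill[OF w0] w0_ne w0 WV by (auto simp: subset_iff)
  then obtain k' where k': "k = Suc k'" by (cases k) auto
  have "\<not> (\<forall>w\<in>W. A ^\<^sub>m k' *\<^sub>v w = 0\<^sub>v (2*n))"
    using not_less_Least[of k' "\<lambda>k. \<forall>w\<in>W. A ^\<^sub>m k *\<^sub>v w = 0\<^sub>v (2*n)"] k' unfolding k_def by simp
  then obtain w where w: "w \<in> W" "A ^\<^sub>m k' *\<^sub>v w \<noteq> 0\<^sub>v (2*n)" by auto
  define z where "z = A ^\<^sub>m k' *\<^sub>v w"
  have zW: "z \<in> W" unfolding z_def by (rule W_A[OF w(1)])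
  have zV: "z \<in> V" using zW WV by auto
  have Hz: "H *\<^sub>v z \<in> V" using zV by (intro mult_mat_vec_carrier[of _ _ "2*n"]) auto
  have Hz_ne: "H *\<^sub>v z \<noteq> 0\<^sub>v (2*n)"
  proof
    assume 0: "H *\<^sub>v z = 0\<^sub>v (2*n)"
    obtain B where B: "inverts_mat H B" "inverts_mat B H" using H_inv by (auto simp: invertible_mat_def)
    have BH: "B * H = 1\<^sub>m (dim_row B)" using B by (simp add: inverts_mat_def)
    then have "dim_row B = 2*n" by (metis index_mult_mat(3) index_one_mat(3) H_dim(2))
    moreover have "dim_col B = 2*n" using B(1) by (metis inverts_mat_def index_mult_mat(3) index_one_mat(3) H_dim(1))
    ultimately have Bc: "B \<in> carrier_mat (2*n) (2*n)" by auto
    have "z = B * H *\<^sub>v z" unfolding BH using zV Bc by simp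
    also have "\<dots> = B *\<^sub>v 0\<^sub>v (2*n)" using zV Bc 0 by (simp add: mat_vec_assoc)
    also have "\<dots> = 0\<^sub>v (2*n)" using Bc by (intro eq_vecI) (auto simp: scalar_prod_def)
    finally show False using w by (simp add: z_def)
  qed
  \<comment> \<open>The inner product of \<open>H *\<^sub>v z\<close> with itself is not 0. Since
    \<open>z\<close> is H-orthogonal to the frame, subtracting the projection from the left factor
    keeps this value and brings that factor into W.\<close>
  define u where "u = H *\<^sub>v z - P *\<^sub>v (H *\<^sub>v z)"
  have uW: "u \<in> W" unfolding u_def by (rule proj[OF Hz])
  have PHz: "P *\<^sub>v (H *\<^sub>v z) \<in> V" by (rule mult_mat_vec_carrier[OF P Hz])
  have "ip (P *\<^sub>v (H *\<^sub>v z)) (H *\<^sub>v z) = 0"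
  proof -
    define y where "y = G * (adj S * H) *\<^sub>v (H *\<^sub>v z)"
    have y: "y \<in> carrier_vec (2 * ?N)" unfolding y_def
      by (rule mult_mat_vec_carrier[OF mult_carrier_mat[OF G SH] Hz])
    have "P *\<^sub>v (H *\<^sub>v z) = S *\<^sub>v y" unfolding P_def y_def using carrier_vecD[OF Hz] by (intro mat_vec_assoc) auto
    then have "ip (P *\<^sub>v (H *\<^sub>v z)) (H *\<^sub>v z) = ip (adj (adj S) *\<^sub>v y) (H *\<^sub>v z)" by simp
    also have "\<dots> = ip y (adj S *\<^sub>v (H *\<^sub>v z))"
      by (rule ip_mult_mat_vec[OF adj_carrier[OF S] y Hz, symmetric])
    also have "adj S *\<^sub>v (H *\<^sub>v z) = adj S * H *\<^sub>v z" using zV by (intro mat_vec_assoc[symmetric]) auto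
    also have "\<dots> = 0\<^sub>v (2 * ?N)" using zW by (auto simp: W_def)
    finally show ?thesis by simp
  qed
  moreover have "ip (H *\<^sub>v z) (H *\<^sub>v z) = ip (u + P *\<^sub>v (H *\<^sub>v z)) (H *\<^sub>v z)"
  proof -
    have "u + P *\<^sub>v (H *\<^sub>v z) = H *\<^sub>v z" unfolding u_def using P by (intro eq_vecI) auto
    then show ?thesis by simp
  qed
  ultimately have "ip (H *\<^sub>v z) (H *\<^sub>v z) = ip u (H *\<^sub>v z)"
    using ip_add_left[of u "2*n" "P *\<^sub>v (H *\<^sub>v z)" "H *\<^sub>v z"] uW WV PHz Hz by auto
  moreover have "ip u (H *\<^sub>v z) = form k' u w"
    unfolding form_def z_def using w WV by (subst mat_vec_assoc) auto
  ultimately have "form k' u w \<noteq> 0" using ip_self_eq_0[OF Hz] Hz_ne by auto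
  then obtain x where x: "x \<in> {u, w, u + w, u + \<i> \<cdot>\<^sub>v w}" "form k' x x \<noteq> 0"
    using polarization[of u w k'] uW w WV by blast
  have xW: "x \<in> W" using x(1) uW w W_add W_smult by auto
  obtain y \<epsilon> where y: "y \<in> W" "\<epsilon> \<in> {1, -1 :: int}" "\<And>p. form p y y = (if p = k' then of_int \<epsilon> else 0)"
    using normalise_chain[OF WV W_add W_smult W_A kill[unfolded k'] xW x(2)] by metis
  have "frame (hcat (chain_mat k y) Y) ((k,\<epsilon>) # ks)"
  proof (rule frame_Cons[OF f _ y(2)])
    show "0 < k" using k' by simp
    show "y \<in> V" using y WV by auto
    show "A ^\<^sub>m k *\<^sub>v y = 0\<^sub>v (2*n)" by (rule kill[OF y(1)])
    show "form p y y = (if p = k - 1 then of_int \<epsilon> else 0)" for p using y(3) k' by simp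
    show "adj (hcat Y (quat_conj n Y)) * H *\<^sub>v (A ^\<^sub>m p *\<^sub>v y) = 0\<^sub>v (2 * ?N)" for p
      using W_A[OF y(1), of p] by (simp add: W_def S_def)
  qed
  then show ?thesis using that k' by blast
qed

lemma frame_complete:
  assumes nilp: "A ^\<^sub>m K = 0\<^sub>m (2*n) (2*n)"
  obtains Y ks where "frame Y ks" "blocks_dim ks = n"
proof -
  have empty: "frame (0\<^sub>m (2*n) 0) []"
    unfolding frame_def by (auto simp: blocks_dim_def jordan_blocks_def sip_blocks_def intro!: eq_matI)
  \<comment> \<open>Every extension adds a chain of positive length and frames have at most
    \<open>n\<close> columns, so \<open>s\<close> counts guaranteed progress.\<close>
  have "\<exists>Y ks. frame Y ks \<and> (blocks_dim ks = n \<or> blocks_dim ks \<ge> s)" for s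
  proof (induction s)
    case 0
    then show ?case using empty by auto
  next
    case (Suc s)
    then obtain Y ks where f: "frame Y ks" "blocks_dim ks = n \<or> blocks_dim ks \<ge> s" by auto
    show ?case
    proof (cases "blocks_dim ks = n")
      case False
      then obtain Y' k e where "frame Y' ((k,e) # ks)" "0 < k" using frame_extend[OF f(1) False nilp] by metis
      then show ?thesis using f(2) False by (intro exI[of _ Y'] exI[of _ "(k,e) # ks"]) (auto simp: blocks_dim_def)
    qed (use f in auto)
  qed
  from this[of n] show ?thesis using that frame_dim_le by (metis le_antisym)
qed

text \<open>With \<open>n\<close> chain vectors \<open>S\<close> is square, so the left inverse
  built from the Gram matrix is the inverse \<open>T\<close>.\<close>

theorem canonical_form:
  assumes nilp: "A ^\<^sub>m K = 0\<^sub>m (2*n) (2*n)"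
  obtains S T ks where "in_Omega n S" "T \<in> carrier_mat (2*n) (2*n)" "S * T = 1\<^sub>m (2*n)" "T * S = 1\<^sub>m (2*n)"
    "blocks_dim ks = n" "\<forall>(k,e)\<in>set ks. 0 < k \<and> e \<in> {1,-1}"
    "T * A * S = diag_block_mat [jordan_blocks ks, jordan_blocks ks]"
    "adj S * H * S = diag_block_mat [sip_blocks ks, sip_blocks ks]"
proof -
  obtain Y ks where f: "frame Y ks" and N: "blocks_dim ks = n" using frame_complete[OF nilp] .
  define S G J where "S = hcat Y (quat_conj n Y)" and "G = diag_block_mat [sip_blocks ks, sip_blocks ks]"
    and "J = diag_block_mat [jordan_blocks ks, jordan_blocks ks]"
  have S: "S \<in> carrier_mat (2*n) (2*n)" unfolding S_def using frame_double(1)[OF f] N by simp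
  have G: "G \<in> carrier_mat (2*n) (2*n)" unfolding G_def mult_2
    using sip_blocks_carrier[of ks] N by (intro diag_block_mat_pair_carrier) auto
  have J: "J \<in> carrier_mat (2*n) (2*n)" unfolding J_def mult_2
    using jordan_blocks_carrier[of ks] N by (intro diag_block_mat_pair_carrier) auto
  note dims [simp] = carrier_matD[OF S] carrier_matD[OF G] carrier_matD[OF J]
  define T where "T = G * (adj S * H)"
  have T: "T \<in> carrier_mat (2*n) (2*n)" unfolding T_def using S G by auto
  have TS: "T * S = 1\<^sub>m (2*n)" unfolding T_def using frame_double(4)[OF f] N
    unfolding S_def[symmetric] G_def[symmetric] by (simp add: mat_assoc)
  have ST: "S * T = 1\<^sub>m (2*n)" by (rule mat_mult_left_right_inverse[OF T S TS])
  have "in_Omega n S" unfolding S_def using f N by (intro in_Omega_hcat_quat_conj) (auto simp: frame_def)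
  moreover have "T * A * S = J"
  proof -
    have "T * A * S = T * (S * J)" using frame_double(2)[OF f] T
      unfolding S_def[symmetric] J_def[symmetric] by (simp add: mat_assoc)
    also have "\<dots> = T * S * J" using T by (intro mat_assoc[symmetric]) auto
    finally show ?thesis unfolding TS using J by simp
  qed
  moreover have "adj S * H * S = G"
    using frame_double(3)[OF f] unfolding S_def[symmetric] G_def[symmetric] by (simp add: mat_assoc)
  moreover have "\<forall>(k,e)\<in>set ks. 0 < k \<and> e \<in> {1,-1}" using f by (simp add: frame_def)
  ultimately show ?thesis using that[of S T ks] T ST TS N unfolding G_def J_def by blast
qed

end

section \<open>Index shifts and joining of orthogonal chains for a single block\<close>

lemma Qmat_mult_index:
  assumes "X \<in> carrier_mat k c" "i < k" "j < c"
  shows "(Qmat k * X) $$ (i,j) = X $$ (k - 1 - i, j)"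
proof -
  have eq: "i + l = k - 1 \<longleftrightarrow> l = k - 1 - i" for l using assms by auto
  have "(Qmat k * X) $$ (i,j) = (\<Sum>l = 0..<k. if l = k - 1 - i then X $$ (l,j) else 0)"
  proof -
    have "(Qmat k * X) $$ (i,j) = (\<Sum>l = 0..<k. Qmat k $$ (i,l) * X $$ (l,j))"
      using assms carrier_matD[OF Qmat_carrier, of k] by (simp add: scalar_prod_def)
    also have "\<dots> = (\<Sum>l = 0..<k. if l = k - 1 - i then X $$ (l,j) else 0)"
      by (rule sum.cong) (use assms eq in \<open>auto simp: Qmat_def\<close>)
    finally show ?thesis .
  qed
  also have "\<dots> = X $$ (k - 1 - i, j)" using assms by (subst sum.delta) auto
  finally show ?thesis .
qed

lemma jordan_block_pow_mult_index:
  assumes "X \<in> carrier_mat k c" "i < k" "j < c"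
  shows "(jordan_block k (0::complex) ^\<^sub>m m * X) $$ (i,j) = (if i + m < k then X $$ (i + m, j) else 0)"
proof -
  have "(jordan_block k (0::complex) ^\<^sub>m m * X) $$ (i,j) = (\<Sum>l = 0..<k. if l = i + m then X $$ (l,j) else 0)"
  proof -
    have "(jordan_block k (0::complex) ^\<^sub>m m * X) $$ (i,j)
       = (\<Sum>l = 0..<k. (jordan_block k (0::complex) ^\<^sub>m m) $$ (i,l) * X $$ (l,j))"
      using assms by (simp add: scalar_prod_def)
    also have "\<dots> = (\<Sum>l = 0..<k. if l = i + m then X $$ (l,j) else 0)"
      by (rule sum.cong) (use assms in \<open>auto simp: jordan_block_zero_pow\<close>)
    finally show ?thesis .
  qed
  also have "\<dots> = (if i + m < k then X $$ (i + m, j) else 0)" by (subst sum.delta) auto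
  finally show ?thesis .
qed

lemma adj_mult_entry:
  "dim_row X = dim_row Z \<Longrightarrow> i < dim_col X \<Longrightarrow> j < dim_col Z \<Longrightarrow>
    (adj X * Z) $$ (i,j) = (\<Sum>q = 0..<dim_row Z. cnj (X $$ (q,i)) * Z $$ (q,j))"
  by (simp add: scalar_prod_def)

lemma foldr_hcat:
  assumes "\<And>i. i \<in> set is \<Longrightarrow> X i \<in> carrier_mat d (l i)"
  shows "foldr hcat (map X is) (0\<^sub>m d 0) \<in> carrier_mat d (sum_list (map l is))"
  using assms by (induction "is") auto

lemma mult_foldr_hcat_zero:
  assumes "\<And>i. i \<in> set is \<Longrightarrow> X i \<in> carrier_mat d (l i)"
    and "\<And>i. i \<in> set is \<Longrightarrow> Z * X i = 0\<^sub>m z (l i)" and "dim_col Z = d" and "dim_row Z = z"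
  shows "Z * foldr hcat (map X is) (0\<^sub>m d 0) = 0\<^sub>m z (sum_list (map l is))"
  using assms(1,2)
proof (induction "is")
  case Nil
  then show ?case using assms(3,4) by (auto intro!: eq_matI)
next
  case (Cons i "is")
  let ?F = "foldr hcat (map X is) (0\<^sub>m d 0)"
  have F: "?F \<in> carrier_mat d (sum_list (map l is))" using Cons.prems by (intro foldr_hcat) auto
  have X: "X i \<in> carrier_mat d (l i)" using Cons.prems by auto
  have "Z * hcat (X i) ?F = hcat (Z * X i) (Z * ?F)"
    using assms(3) F X by (intro mult_hcat) auto
  also have "Z * X i = 0\<^sub>m z (l i)" using Cons.prems by auto
  also have "Z * ?F = 0\<^sub>m z (sum_list (map l is))" using Cons by auto
  finally show ?case by (auto intro!: eq_matI)
qed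

text \<open>Applied to a single real block, with \<open>M\<close> the \<open>m\<close>-th power of a
  Jordan block and \<open>H\<close> a signed \<open>Qmat\<close>: pairwise orthogonal chains join to
  a basis in which both matrices are block-diagonal.\<close>

lemma concat_frames:
  fixes X :: "'i \<Rightarrow> complex mat"
  assumes M: "M \<in> carrier_mat d d" and H: "H \<in> carrier_mat d d" "adj H = H" and "distinct is"
    and X: "\<And>i. i \<in> set is \<Longrightarrow> X i \<in> carrier_mat d (l i)"
    and J: "\<And>i. i \<in> set is \<Longrightarrow> J i \<in> carrier_mat (l i) (l i)"
    and MX: "\<And>i. i \<in> set is \<Longrightarrow> M * X i = X i * J i"
    and gram: "\<And>i j. i \<in> set is \<Longrightarrow> j \<in> set is \<Longrightarrow>
       adj (X i) * (H * X j) = (if i = j then G i else 0\<^sub>m (l i) (l j))"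
  defines "Y \<equiv> foldr hcat (map X is) (0\<^sub>m d 0)"
  shows "M * Y = Y * diag_block_mat (map J is) \<and> adj Y * (H * Y) = diag_block_mat (map G is)"
  unfolding Y_def using assms(4-8)
proof (induction "is")
  case Nil
  then show ?case using M H by (auto intro!: eq_matI)
next
  case (Cons i "is")
  let ?F = "foldr hcat (map X is) (0\<^sub>m d 0)" and ?N = "sum_list (map l is)"
  have F: "?F \<in> carrier_mat d ?N" using Cons.prems by (intro foldr_hcat) auto
  have Xi: "X i \<in> carrier_mat d (l i)" and Ji: "J i \<in> carrier_mat (l i) (l i)" using Cons.prems by auto
  have IH: "M * ?F = ?F * diag_block_mat (map J is)" "adj ?F * (H * ?F) = diag_block_mat (map G is)"
    using Cons.IH Cons.prems by auto
  have Gi: "adj (X i) * (H * X i) = G i" using Cons.prems by auto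
  have XF: "adj (X i) * (H * ?F) = 0\<^sub>m (l i) ?N"
  proof -
    have "adj (X i) * H * X j = 0\<^sub>m (l i) (l j)" if j: "j \<in> set is" for j
    proof -
      have Xj: "X j \<in> carrier_mat d (l j)" and "i \<noteq> j" using Cons.prems j by auto
      then have "adj (X i) * (H * X j) = 0\<^sub>m (l i) (l j)" using Cons.prems(5)[of i j] j by simp
      then show ?thesis using Xi Xj H by (subst mat_assoc) auto
    qed
    then have "adj (X i) * H * ?F = 0\<^sub>m (l i) ?N"
      using Cons.prems Xi H by (intro mult_foldr_hcat_zero) auto
    then show ?thesis using Xi H F by (subst mat_assoc[symmetric]) auto
  qed
  have FX: "adj ?F * (H * X i) = 0\<^sub>m ?N (l i)"
  proof -
    have "adj (adj (X i) * (H * ?F)) = adj ?F * (H * X i)"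
      using Xi F H by (simp add: adj_mult mat_assoc)
    then show ?thesis unfolding XF by simp
  qed
  have JN: "diag_block_mat (map J is) \<in> carrier_mat ?N ?N"
  proof -
    have 1: "map dim_row (map J is) = map l is" "map dim_col (map J is) = map l is"
      using Cons.prems(3) by auto
    show ?thesis by (rule carrier_matI) (simp_all only: dim_diag_block_mat 1)
  qed
  have GN: "diag_block_mat (map G is) \<in> carrier_mat ?N ?N"
    unfolding IH(2)[symmetric] using F H by auto
  have "G i \<in> carrier_mat (l i) (l i)" unfolding Gi[symmetric] using Xi H by auto
  note Gc = diag_block_mat_Cons[OF this GN] and Jc = diag_block_mat_Cons[OF Ji JN]
  have "M * hcat (X i) ?F = hcat (X i) ?F * diag_block_mat (J i # map J is)"
  proof -
    have "M * hcat (X i) ?F = hcat (M * X i) (M * ?F)" using M Xi F by (intro mult_hcat) auto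
    also have "\<dots> = hcat (X i) ?F * diag_block_mat (J i # map J is)"
      unfolding Jc IH using hcat_mult_diag[OF Xi F Ji JN] Cons.prems by simp
    finally show ?thesis .
  qed
  moreover have "adj (hcat (X i) ?F) * (H * hcat (X i) ?F) = diag_block_mat (G i # map G is)"
  proof -
    have "H * hcat (X i) ?F = hcat (H * X i) (H * ?F)" using H Xi F by (intro mult_hcat) auto
    moreover have "adj (hcat (X i) ?F) * hcat (H * X i) (H * ?F)
      = four_block_mat (adj (X i) * (H * X i)) (adj (X i) * (H * ?F)) (adj ?F * (H * X i)) (adj ?F * (H * ?F))"
      using H Xi F by (intro adj_hcat_mult_hcat) auto
    ultimately show ?thesis unfolding Gc Gi XF FX IH by simp
  qed
  ultimately show ?case by simp
qed

lemma cnj_foldr_hcat: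
  assumes "\<And>i. i \<in> set is \<Longrightarrow> X i \<in> carrier_mat d (l i)"
    and "\<And>i. i \<in> set is \<Longrightarrow> map_mat cnj (X i) = X i"
  shows "map_mat cnj (foldr hcat (map X is) (0\<^sub>m d 0)) = foldr hcat (map X is) (0\<^sub>m d 0)"
  using assms
proof (induction "is")
  case (Cons i "is")
  have "foldr hcat (map X is) (0\<^sub>m d 0) \<in> carrier_mat d (sum_list (map l is))"
    using Cons.prems by (intro foldr_hcat) auto
  then have "dim_row (foldr hcat (map X is) (0\<^sub>m d 0)) = dim_row (X i)" using Cons.prems(1)[of i] by auto
  then show ?case using Cons by (simp add: cnj_hcat)
qed (auto intro!: eq_matI)

section \<open>Powers of a nilpotent block\<close>

text \<open>
  \<open>len g\<close> is the length of the chain of indices congruent to \<open>g\<close> modulo \<open>m\<close>, and \<open>\<tau> g\<close> the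
  chain it is paired with. \<open>\<alpha>\<close> and \<open>\<beta>\<close> are a rational diagonalisation of the hyperbolic
  plane: the vectors $(1, 1/2)$ and $(-1, 1/2)$ are orthogonal of square $1$ and $-1$ for the form $2uv$.
\<close>

locale power_block =
  fixes m a r :: nat
  assumes r: "0 < r" "r \<le> m"
begin

definition k where "k = a * m + r"
definition len where "len g = (if g < r then a + 1 else a)"
definition \<tau> where "\<tau> g = (if g < r then r - 1 - g else m + r - 1 - g)"
definition \<alpha> :: "nat \<Rightarrow> complex" where "\<alpha> g = (if g \<le> \<tau> g then 1 else 1/2)"
definition \<beta> :: "nat \<Rightarrow> complex" where "\<beta> g = (if g < \<tau> g then 1/2 else if g = \<tau> g then 0 else -1)"
definition sg :: "nat \<Rightarrow> int" where "sg g = (if g \<le> \<tau> g then 1 else -1)"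

text \<open>The \<open>g\<close>-th chain after diagonalisation: column p combines the indices
  \<open>p * m + g\<close> and \<open>p * m + \<tau> g\<close>. For a self-paired chain \<beta>
  vanishes, so its index is counted once.\<close>

definition X :: "nat \<Rightarrow> complex mat" where
  "X g = mat k (len g) (\<lambda>(q,p). (if q = p * m + g then \<alpha> g else 0) + (if q = p * m + \<tau> g then \<beta> g else 0))"

lemma X_carrier [simp, intro]: "X g \<in> carrier_mat k (len g)"
  by (simp add: X_def)

lemmas X_dim [simp] = carrier_matD[OF X_carrier]

lemma tau: "g < m \<Longrightarrow> \<tau> g < m" "g < m \<Longrightarrow> \<tau> (\<tau> g) = g" "g < m \<Longrightarrow> len (\<tau> g) = len g"
  using r by (auto simp: \<tau>_def len_def)

lemma index_less:
  assumes "g < m" "p < len g"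
  shows "p * m + g < k"
proof (cases "g < r")
  case True
  then have "p * m \<le> a * m" using assms by (auto simp: len_def)
  then show ?thesis unfolding k_def using True by linarith
next
  case False
  then have "Suc p \<le> a" using assms by (auto simp: len_def)
  then have "Suc p * m \<le> a * m" by (rule mult_le_mono1)
  then show ?thesis unfolding k_def mult_Suc using assms by linarith
qed

text \<open>\<open>Qmat k\<close> pairs two indices whose sum is k - 1, that is
  \<open>a * m + (r - 1)\<close>. Splitting both by quotient and remainder modulo m, the remainders
  sum to r - 1 without a carry or to m + r - 1 with one; these are the two clauses of \<tau>, and
  the carry is the difference between the lengths a + 1 and a.\<close>

lemma index_sum:
  assumes g: "g < m" "p < len g" and h: "h < m" "p' < len h"
  shows "p * m + g + (p' * m + h) = k - 1 \<longleftrightarrow> h = \<tau> g \<and> p + p' = len g - 1"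
proof
  assume "p * m + g + (p' * m + h) = k - 1"
  then have eq: "(p + p') * m + (g + h) = a * m + r - 1" by (simp add: k_def algebra_simps)
  \<comment> \<open>Remainders below m sum to at most 2m - 2, so neither two carries nor a borrow is
    possible; the last two cases are void.\<close>
  consider "p + p' = a" | "a = Suc (p + p')" | "Suc (Suc (p + p')) \<le> a" | "Suc a \<le> p + p'" by linarith
  then show "h = \<tau> g \<and> p + p' = len g - 1"
  proof cases
    case 1
    then have "g + h = r - 1" using eq r by simp
    then show ?thesis using r 1 by (auto simp: \<tau>_def len_def)
  next
    case 2
    then have gh: "g + h = m + r - 1" using eq r by simp
    then have "\<not> g < r" using h by linarith
    then have "len g = a" "h = \<tau> g" using gh by (auto simp: \<tau>_def len_def)
    then show ?thesis using 2 by linarith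
  next
    case 3
    then have "Suc (Suc (p + p')) * m \<le> a * m" by (rule mult_le_mono1)
    then have False using eq r g h by simp
    then show ?thesis ..
  next
    case 4
    then have "Suc a * m \<le> (p + p') * m" by (rule mult_le_mono1)
    then have False using eq r g h by simp
    then show ?thesis ..
  qed
next
  assume *: "h = \<tau> g \<and> p + p' = len g - 1"
  have "p * m + g + (p' * m + h) = (p + p') * m + (g + h)" by (simp add: algebra_simps)
  also have "\<dots> = k - 1"
  proof (cases "g < r")
    case True
    then show ?thesis using * r by (simp add: \<tau>_def len_def k_def)
  next
    case False
    then have "len g = a" "g + h = m + r - 1" using * g by (auto simp: len_def \<tau>_def)
    then have "a = Suc (p + p')" "g + h = m + r - 1" using * g by auto
    then have "a * m = (p + p') * m + m" "g + h = m + r - 1" by (metis mult_Suc add.commute, simp)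
    then show ?thesis unfolding k_def using r by linarith
  qed
  finally show "p * m + g + (p' * m + h) = k - 1" .
qed

text \<open>The power lowers every index by m, hence p by one at fixed remainder, and kills the
  indices below m. Chain \<tau> g has the same length as chain g, so both parts of a column move
  together.\<close>

lemma pow_mult_X:
  assumes g: "g < m"
  shows "jordan_block k 0 ^\<^sub>m m * X g = X g * jordan_block (len g) 0"
proof (rule eq_matI)
  fix q p assume "q < dim_row (X g * jordan_block (len g) 0)" "p < dim_col (X g * jordan_block (len g) (0::complex))"
  then have qp: "q < k" "p < len g" by auto
  have b: "p * m + g < k" "p * m + \<tau> g < k" using index_less[of g p] index_less[of "\<tau> g" p] g qp tau[of g] by auto
  have "(if q + m < k then X g $$ (q + m, p) else 0) = (if p = 0 then 0 else X g $$ (q, p - 1))"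
  proof (cases p)
    case 0
    then show ?thesis using qp g tau(1)[OF g] by (simp add: X_def)
  next
    case (Suc p')
    have eq: "q + m = p * m + g \<longleftrightarrow> q = p' * m + g" "q + m = p * m + \<tau> g \<longleftrightarrow> q = p' * m + \<tau> g"
      using Suc by auto
    have "X g $$ (q, p') = (if q = p' * m + g then \<alpha> g else 0) + (if q = p' * m + \<tau> g then \<beta> g else 0)"
      using qp Suc by (simp add: X_def)
    moreover have "X g $$ (q + m, p) = (if q = p' * m + g then \<alpha> g else 0) + (if q = p' * m + \<tau> g then \<beta> g else 0)"
      if "q + m < k" using qp that eq by (simp add: X_def)
    \<comment> \<open>Rows shifted in from beyond the bottom edge are zero, and so are the
      corresponding entries of column p - 1, since the indices of column p are below k.\<close>
    moreover have "q \<noteq> p' * m + g \<and> q \<noteq> p' * m + \<tau> g" if "\<not> q + m < k" using b that eq by metis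
    ultimately show ?thesis using Suc by simp
  qed
  then show "(jordan_block k 0 ^\<^sub>m m * X g) $$ (q,p) = (X g * jordan_block (len g) 0) $$ (q,p)"
    unfolding jordan_block_pow_mult_index[OF X_carrier qp] mult_jordan_block_index[OF X_carrier qp] .
qed auto

text \<open>By \<open>index_sum\<close> all four products of the two-term columns are governed by
  the same anti-diagonal condition \<open>E\<close>. What is left is a 2 by 2 computation: for a
  proper pair the columns of g and \<tau> g are orthogonal, and
  \<open>2 * \<alpha> g * \<beta> g\<close> is 1 or -1.\<close>

lemma gram_X:
  assumes g: "g < m" and h: "h < m"
  shows "adj (X g) * (Qmat k * X h) = (if g = h then of_int (sg g) \<cdot>\<^sub>m Qmat (len g) else 0\<^sub>m (len g) (len h))"
    (is "_ = ?R")
proof (rule eq_matI)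
  show dr: "dim_row (adj (X g) * (Qmat k * X h)) = dim_row ?R"
    and dc: "dim_col (adj (X g) * (Qmat k * X h)) = dim_col ?R" by (auto simp: Qmat_def)
  fix p p' assume "p < dim_row ?R" "p' < dim_col ?R"
  then have p: "p < len g" "p' < len h" using dr dc by auto
  define E where "E \<longleftrightarrow> p + p' = len g - 1"
  have u: "p * m + g < k" "p * m + \<tau> g < k" "p' * m + h < k" "p' * m + \<tau> h < k"
    using index_less[of g p] index_less[of "\<tau> g" p] index_less[of h p'] index_less[of "\<tau> h" p'] g h p tau by auto
  have S: "(\<Sum>q = 0..<k. ((if q = u then c else 0) + (if q = u' then c' else 0)) * f q) = c * f u + c' * f u'"
    if "u < k" "u' < k" for u u' and c c' :: complex and f
    using that by (simp add: distrib_right sum.distrib if_distrib[of "\<lambda>x. x * _"] cong: if_cong)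
  have Xh: "X h $$ (k - 1 - q, p') = (if q + (p' * m + h) = k - 1 then \<alpha> h else 0) + (if q + (p' * m + \<tau> h) = k - 1 then \<beta> h else 0)"
    if "q < k" for q
  proof -
    have "k - 1 - q = v \<longleftrightarrow> q + v = k - 1" for v using that by auto
    then show ?thesis using that p by (simp add: X_def)
  qed
  have "(adj (X g) * (Qmat k * X h)) $$ (p,p') = (\<Sum>q = 0..<k. cnj (X g $$ (q,p)) * (Qmat k * X h) $$ (q,p'))"
    using p carrier_matD[OF Qmat_carrier, of k] by (subst adj_mult_entry) auto
  also have "\<dots> = (\<Sum>q = 0..<k. ((if q = p * m + g then \<alpha> g else 0) + (if q = p * m + \<tau> g then \<beta> g else 0)) *
       X h $$ (k - 1 - q, p'))"
  proof (rule sum.cong)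
    fix q assume "q \<in> {0..<k}"
    then have q: "q < k" by simp
    have "cnj (X g $$ (q,p)) = (if q = p * m + g then \<alpha> g else 0) + (if q = p * m + \<tau> g then \<beta> g else 0)"
      using q p by (simp add: X_def \<alpha>_def \<beta>_def)
    then show "cnj (X g $$ (q,p)) * (Qmat k * X h) $$ (q,p') =
      ((if q = p * m + g then \<alpha> g else 0) + (if q = p * m + \<tau> g then \<beta> g else 0)) * X h $$ (k - 1 - q, p')"
      by (simp only: Qmat_mult_index[OF X_carrier q p(2)])
  qed simp
  also have "\<dots> = \<alpha> g * X h $$ (k - 1 - (p * m + g), p') + \<beta> g * X h $$ (k - 1 - (p * m + \<tau> g), p')"
    by (rule S[OF u(1,2)])
  also have "\<dots> = \<alpha> g * ((if h = \<tau> g \<and> E then \<alpha> h else 0) + (if g = h \<and> E then \<beta> h else 0))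
     + \<beta> g * ((if g = h \<and> E then \<alpha> h else 0) + (if h = \<tau> g \<and> E then \<beta> h else 0))"
  proof -
    have t: "\<tau> g < m" "\<tau> h < m" "p < len (\<tau> g)" "p' < len (\<tau> h)" using tau g h p by auto
    have 1: "p * m + g + (p' * m + h) = k - 1 \<longleftrightarrow> h = \<tau> g \<and> E"
      using index_sum[OF g p(1) h p(2)] by (simp add: E_def)
    have inj: "\<tau> h = \<tau> g \<longleftrightarrow> g = h" using tau(2)[OF g] tau(2)[OF h] by metis
    have swap: "\<tau> h = g \<longleftrightarrow> h = \<tau> g" using tau(2)[OF g] tau(2)[OF h] by metis
    have 2: "p * m + g + (p' * m + \<tau> h) = k - 1 \<longleftrightarrow> g = h \<and> E"
      unfolding index_sum[OF g p(1) t(2,4)] inj E_def ..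
    have 3: "p * m + \<tau> g + (p' * m + h) = k - 1 \<longleftrightarrow> g = h \<and> E"
      unfolding index_sum[OF t(1,3) h p(2)] tau(2,3)[OF g] E_def by blast
    have 4: "p * m + \<tau> g + (p' * m + \<tau> h) = k - 1 \<longleftrightarrow> h = \<tau> g \<and> E"
      unfolding index_sum[OF t(1,3) t(2,4)] tau(2,3)[OF g] swap E_def ..
    show ?thesis unfolding Xh[OF u(1)] Xh[OF u(2)] 1 2 3 4 ..
  qed
  also have "\<dots> = ?R $$ (p,p')"
    using p tau(2)[OF g] by (auto simp: Qmat_def E_def \<alpha>_def \<beta>_def sg_def)
  finally show "(adj (X g) * (Qmat k * X h)) $$ (p,p') = ?R $$ (p,p')" .
qed

end

section \<open>Matching balanced signs with the sign pattern of a power\<close>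

lemma balanced_signs_card:
  assumes "finite I" and "\<And>i. i \<in> I \<Longrightarrow> e i \<in> {1,-1}" and "\<eta> \<in> {1,-1}" and "balanced_signs e I \<eta>"
  shows "card {i \<in> I. e i = \<eta>} = (card I + 1) div 2" "card {i \<in> I. e i = - \<eta>} = card I div 2"
proof -
  have "e i = \<eta> \<or> e i = - \<eta>" if "i \<in> I" for i using assms(2)[OF that] assms(3) by auto
  then have "I = {i \<in> I. e i = \<eta>} \<union> {i \<in> I. e i = - \<eta>}" by blast
  then have "card I = card ({i \<in> I. e i = \<eta>} \<union> {i \<in> I. e i = - \<eta>})" by simp
  also have "\<dots> = card {i \<in> I. e i = \<eta>} + card {i \<in> I. e i = - \<eta>}"
    using assms by (intro card_Un_disjoint) auto
  finally have c: "card I = card {i \<in> I. e i = \<eta>} + card {i \<in> I. e i = - \<eta>}" .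
  have arith: "p = (s + 1) div 2 \<and> q = s div 2"
    if "s = p + q" "if even s then p = q else p = q + 1" for s p q :: nat
    using that by (cases "even s") auto
  show "card {i \<in> I. e i = \<eta>} = (card I + 1) div 2" "card {i \<in> I. e i = - \<eta>} = card I div 2"
    using arith[OF c assms(4)[unfolded balanced_signs_def]] by blast+
qed

text \<open>Sorts the signs: after relabelling by \<pi>, the first half, rounded up, carries \<eta>
  and the rest its negative. The inequality is phrased so as to become
  \<open>g \<le> \<tau> g\<close> for chains of equal length.\<close>

lemma balanced_signs_bij:
  assumes I: "finite I" and e: "\<And>i. i \<in> I \<Longrightarrow> e i \<in> {1,-1}" and \<eta>: "\<eta> \<in> {1,-1}" and b: "balanced_signs e I \<eta>"
  obtains \<pi> where "bij_betw \<pi> I {c..<c + card I}"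
    "\<forall>i\<in>I. e i = (if 2 * (\<pi> i - c) + 1 \<le> card I then \<eta> else - \<eta>)"
proof -
  let ?s = "card I"
  let ?P = "{i \<in> I. e i = \<eta>}" and ?N = "{i \<in> I. e i = - \<eta>}"
  let ?C = "{c..<c + (?s + 1) div 2}" and ?D = "{c + (?s + 1) div 2..<c + ?s}"
  note cards = balanced_signs_card[OF I e \<eta> b]
  have "\<exists>f. bij_betw f ?P ?C" by (rule finite_same_card_bij) (simp_all add: I cards)
  then obtain f where f: "bij_betw f ?P ?C" ..
  have "\<exists>g. bij_betw g ?N ?D" by (rule finite_same_card_bij) (simp_all add: I cards)
  then obtain g where g: "bij_betw g ?N ?D" ..
  define \<pi> where "\<pi> i = (if i \<in> ?P then f i else g i)" for i
  have "e i = \<eta> \<or> e i = - \<eta>" if "i \<in> I" for i using e[OF that] \<eta> by auto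
  then have PN: "?P \<union> ?N = I" "?P \<inter> ?N = {}" using \<eta> by auto
  have CD: "?C \<union> ?D = {c..<c + ?s}" "?C \<inter> ?D = {}" by auto
  have bij: "bij_betw \<pi> I {c..<c + ?s}"
    using bij_betw_disjoint_Un[OF f g PN(2) CD(2)] unfolding PN(1) CD(1) \<pi>_def .
  have "e i = (if 2 * (\<pi> i - c) + 1 \<le> card I then \<eta> else - \<eta>)" if i: "i \<in> I" for i
  proof (cases "i \<in> ?P")
    case True
    then have "\<pi> i \<in> ?C" using f by (auto simp: \<pi>_def bij_betw_def)
    then have "2 * (\<pi> i - c) + 1 \<le> card I" by auto
    then show ?thesis using True by simp
  next
    case False
    then have iN: "i \<in> ?N" using PN i by blast
    then have "\<pi> i \<in> ?D" using g False unfolding \<pi>_def bij_betw_def by auto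
    then have "\<not> 2 * (\<pi> i - c) + 1 \<le> card I" by auto
    then show ?thesis using iN by simp
  qed
  with bij show ?thesis using that by blast
qed

context power_block
begin

text \<open>Long and short chains are matched separately, since both the sign rule and \<tau>
  respect chain length. Block numbers start at 1 and remainders at 0, hence \<open>i \<le> r\<close>
  against \<open>\<pi> i < r\<close>.\<close>

lemma sign_reordering:
  assumes e: "\<And>i. i \<in> {1..m} \<Longrightarrow> e i \<in> {1,-1}" and \<eta>: "\<eta> \<in> {1,-1}"
    and b: "balanced_signs e {1..r} \<eta>" "balanced_signs e {r+1..m} \<eta>"
  obtains \<pi> where "inj_on \<pi> {1..m}" "\<forall>i\<in>{1..m}. \<pi> i < m \<and> (\<pi> i < r \<longleftrightarrow> i \<le> r) \<and> e i = \<eta> * sg (\<pi> i)"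
proof -
  have e1: "e i \<in> {1,-1}" if "i \<in> {1..r}" for i using that r by (intro e) auto
  have e2: "e i \<in> {1,-1}" if "i \<in> {r+1..m}" for i using that r by (intro e) auto
  obtain f where f: "bij_betw f {1..r} {0..<0 + card {1..r}}"
    "\<forall>i\<in>{1..r}. e i = (if 2 * (f i - 0) + 1 \<le> card {1..r} then \<eta> else - \<eta>)"
    using balanced_signs_bij[OF finite_atLeastAtMost e1 \<eta> b(1), of 0] by blast
  obtain g where g: "bij_betw g {r+1..m} {r..<r + card {r+1..m}}"
    "\<forall>i\<in>{r+1..m}. e i = (if 2 * (g i - r) + 1 \<le> card {r+1..m} then \<eta> else - \<eta>)"
    using balanced_signs_bij[OF finite_atLeastAtMost e2 \<eta> b(2), of r] by blast
  define \<pi> where "\<pi> i = (if i \<in> {1..r} then f i else g i)" for i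
  have I: "{1..r} \<union> {r+1..m} = {1..m}" "{1..r} \<inter> {r+1..m} = {}" using r by auto
  have "bij_betw \<pi> ({1..r} \<union> {r+1..m}) ({0..<0 + card {1..r}} \<union> {r..<r + card {r+1..m}})"
    unfolding \<pi>_def by (rule bij_betw_disjoint_Un[OF f(1) g(1)]) auto
  then have "inj_on \<pi> {1..m}" unfolding I by (simp add: bij_betw_def)
  moreover have "\<pi> i < m \<and> (\<pi> i < r \<longleftrightarrow> i \<le> r) \<and> e i = \<eta> * sg (\<pi> i)" if i: "i \<in> {1..m}" for i
  proof (cases "i \<le> r")
    case True
    then have i': "i \<in> {1..r}" and p: "\<pi> i = f i" using i by (auto simp: \<pi>_def)
    have fi: "f i < r" using f(1) i' by (auto simp: bij_betw_def)
    have "2 * f i + 1 \<le> r \<longleftrightarrow> f i \<le> \<tau> (f i)" using fi by (auto simp: \<tau>_def)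
    then have "e i = \<eta> * sg (f i)" using bspec[OF f(2) i'] by (simp add: sg_def)
    then show ?thesis using p fi True r by auto
  next
    case False
    then have i': "i \<in> {r+1..m}" and p: "\<pi> i = g i" using i by (auto simp: \<pi>_def)
    have gi: "r \<le> g i" "g i < m" using g(1) i' r by (auto simp: bij_betw_def)
    have "2 * (g i - r) + 1 \<le> m - r \<longleftrightarrow> g i \<le> \<tau> (g i)" using gi by (auto simp: \<tau>_def)
    then have "e i = \<eta> * sg (g i)" using bspec[OF g(2) i'] by (simp add: sg_def)
    then show ?thesis using p gi False r by auto
  qed
  ultimately show ?thesis using that by blast
qed

lemma sum_list_sizes: "sum_list (map (\<lambda>i. if i \<le> r then a + 1 else a) [1..<m+1]) = k"
proof -
  have "(\<Sum>i\<in>A. if i \<le> r then a + 1 else a) = card A * a + card (A \<inter> {i. i \<le> r})" if "finite A" for A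
  proof -
    have "(\<Sum>i\<in>A. if i \<le> r then a + 1 else a) = (\<Sum>i\<in>A. a + (if i \<le> r then 1 else 0))"
      by (rule sum.cong) auto
    then show ?thesis using that by (simp add: sum.distrib sum.If_cases)
  qed
  from this[of "{1..<m+1}"] have "(\<Sum>i\<in>{1..<m+1}. if i \<le> r then a + 1 else a)
    = m * a + card ({1..<m+1} \<inter> {i. i \<le> r})" by simp
  also have "{1..<m+1} \<inter> {i. i \<le> r} = {1..r}" using r by auto
  finally have "(\<Sum>i\<in>{1..<m+1}. if i \<le> r then a + 1 else a) = k" by (simp add: k_def mult.commute)
  then show ?thesis by (simp only: sum_list_distinct_conv_sum_set distinct_upt set_upt)
qed

text \<open>The columns are the chains \<open>X (\<pi> i)\<close>: with \<pi> free, every balanced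
  order of signs is reached and not just the natural one. Invertibility of \<open>R\<close> is
  extracted later from its Gram matrix.\<close>

lemma real_reduction:
  assumes e: "\<And>i. i \<in> {1..m} \<Longrightarrow> e i \<in> {1,-1}" and \<eta>: "\<eta> \<in> {1,-1}"
    and b: "balanced_signs e {1..r} \<eta>" "balanced_signs e {r+1..m} \<eta>"
  defines "ls \<equiv> \<lambda>i. if i \<le> r then a + 1 else a"
  shows "\<exists>R. R \<in> carrier_mat k k \<and> map_mat cnj R = R \<and>
    jordan_block k 0 ^\<^sub>m m * R = R * diag_block_mat (map (\<lambda>i. jordan_block (ls i) 0) [1..<m+1]) \<and>
    adj R * ((of_int \<eta> \<cdot>\<^sub>m Qmat k) * R) = diag_block_mat (map (\<lambda>i. of_int (e i) \<cdot>\<^sub>m Qmat (ls i)) [1..<m+1])"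
proof -
  obtain \<pi> where inj: "inj_on \<pi> {1..m}"
    and \<pi>': "\<forall>i\<in>{1..m}. \<pi> i < m \<and> (\<pi> i < r \<longleftrightarrow> i \<le> r) \<and> e i = \<eta> * sg (\<pi> i)"
    using sign_reordering[OF e \<eta> b] by blast
  note \<pi> = bspec[OF \<pi>']
  have set: "set [1..<m+1] = {1..m}" by auto
  have len: "len (\<pi> i) = ls i" if "i \<in> {1..m}" for i using \<pi>[OF that] by (auto simp: len_def ls_def)
  define Y where "Y = (\<lambda>i. X (\<pi> i))"
  define R where "R = foldr hcat (map Y [1..<m+1]) (0\<^sub>m k 0)"
  have Y: "Y i \<in> carrier_mat k (ls i)" if "i \<in> {1..m}" for i
    using len[OF that] X_carrier[of "\<pi> i"] by (simp add: Y_def)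
  let ?H = "of_int \<eta> \<cdot>\<^sub>m Qmat k"
  have adjH: "adj ?H = ?H" by (rule eq_matI) (auto simp: Qmat_def)
  have gram: "adj (Y i) * (?H * Y j) = (if i = j then of_int (e i) \<cdot>\<^sub>m Qmat (ls i) else 0\<^sub>m (ls i) (ls j))"
    if ij: "i \<in> {1..m}" "j \<in> {1..m}" for i j
  proof -
    have "?H * Y j = of_int \<eta> \<cdot>\<^sub>m (Qmat k * Y j)"
      using Y[OF ij(2)] by (intro mult_smult_assoc_mat[of _ k k]) auto
    then have "adj (Y i) * (?H * Y j) = of_int \<eta> \<cdot>\<^sub>m (adj (Y i) * (Qmat k * Y j))"
      by (simp only: mult_smult_distrib[OF adj_carrier[OF Y[OF ij(1)]] mult_carrier_mat[OF Qmat_carrier Y[OF ij(2)]]])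
    also have "adj (Y i) * (Qmat k * Y j) = (if \<pi> i = \<pi> j then of_int (sg (\<pi> i)) \<cdot>\<^sub>m Qmat (ls i) else 0\<^sub>m (ls i) (ls j))"
      using \<pi>[OF ij(1)] \<pi>[OF ij(2)] unfolding Y_def by (subst gram_X) (simp_all only: len[OF ij(1)] len[OF ij(2)])
    also have "\<pi> i = \<pi> j \<longleftrightarrow> i = j" by (rule inj_on_eq_iff[OF inj ij])
    finally have g: "adj (Y i) * (?H * Y j) = of_int \<eta> \<cdot>\<^sub>m
      (if i = j then of_int (sg (\<pi> i)) \<cdot>\<^sub>m Qmat (ls i) else 0\<^sub>m (ls i) (ls j))" .
    have ei: "e i = \<eta> * sg (\<pi> i)" using \<pi>[OF ij(1)] by simp
    show ?thesis unfolding g ei by (cases "i = j") (auto intro!: eq_matI)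
  qed
  have MX: "jordan_block k 0 ^\<^sub>m m * Y i = Y i * jordan_block (ls i) 0" if "i \<in> {1..m}" for i
    using pow_mult_X[of "\<pi> i"] \<pi>[OF that] len[OF that] by (simp add: Y_def)
  have main: "jordan_block k 0 ^\<^sub>m m * R = R * diag_block_mat (map (\<lambda>i. jordan_block (ls i) 0) [1..<m+1]) \<and>
    adj R * (?H * R) = diag_block_mat (map (\<lambda>i. of_int (e i) \<cdot>\<^sub>m Qmat (ls i)) [1..<m+1])"
    unfolding R_def
  proof (rule concat_frames[where l = ls], unfold set)
    show "jordan_block k 0 ^\<^sub>m m \<in> carrier_mat k k" "?H \<in> carrier_mat k k" "distinct [1..<m+1]" by simp_all
    show "jordan_block (ls i) 0 \<in> carrier_mat (ls i) (ls i)" for i by simp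
  qed (fact adjH Y MX gram)+
  have "R \<in> carrier_mat k (sum_list (map ls [1..<m+1]))"
    unfolding R_def by (rule foldr_hcat, unfold set) (rule Y)
  then have "R \<in> carrier_mat k k" unfolding ls_def sum_list_sizes .
  moreover have "map_mat cnj (X g) = X g" for g
    by (rule eq_matI) (auto simp: X_def \<alpha>_def \<beta>_def)
  then have "map_mat cnj R = R"
    unfolding R_def by (intro cnj_foldr_hcat[of _ _ _ ls], unfold set) (rule Y, assumption, simp only: Y_def)
  ultimately show ?thesis using main by blast
qed

end

section \<open>Direct sums of powers of blocks\<close>

lemma JB_eq: "JB m t a r = diag_block_mat (map (\<lambda>j. diag_block_mat (map (\<lambda>i.
   jordan_block (if i \<le> r j then a j + 1 else a j) 0) [1..<m+1])) [1..<t+1])"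
  unfolding JB_def diag_block_mat_concat map_map o_def ..

lemma HB_eq: "HB m t a r eps = diag_block_mat (map (\<lambda>j. diag_block_mat (map (\<lambda>i.
   of_int (eps j i) \<cdot>\<^sub>m Qmat (if i \<le> r j then a j + 1 else a j)) [1..<m+1])) [1..<t+1])"
  unfolding HB_def diag_block_mat_concat map_map o_def ..

text \<open>The blocks reduce independently, with one real matrix for each j. As \<open>HB\<close>
  is its own inverse, \<open>HB\<close> times \<open>adj R * sip_blocks ks\<close> is a left inverse
  of \<open>R\<close>.\<close>

lemma real_reduction_sum:
  fixes t m :: nat and a r :: "nat \<Rightarrow> nat" and eps :: "nat \<Rightarrow> nat \<Rightarrow> int" and \<eta> :: "nat \<Rightarrow> int"
  assumes r: "\<And>j. j \<in> {1..t} \<Longrightarrow> 0 < r j \<and> r j \<le> m"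
    and eps: "\<And>i j. j \<in> {1..t} \<Longrightarrow> i \<in> {1..m} \<Longrightarrow> eps j i \<in> {1,-1}"
    and \<eta>: "\<And>j. j \<in> {1..t} \<Longrightarrow> \<eta> j \<in> {1,-1}"
    and b: "\<And>j. j \<in> {1..t} \<Longrightarrow> balanced_signs (eps j) {1..r j} (\<eta> j) \<and> balanced_signs (eps j) {r j + 1..m} (\<eta> j)"
  defines "ks \<equiv> map (\<lambda>j. (a j * m + r j, \<eta> j)) [1..<t+1]"
  obtains R Ri where "R \<in> carrier_mat (blocks_dim ks) (blocks_dim ks)" "Ri \<in> carrier_mat (blocks_dim ks) (blocks_dim ks)"
    "R * Ri = 1\<^sub>m (blocks_dim ks)" "Ri * R = 1\<^sub>m (blocks_dim ks)" "map_mat cnj R = R"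
    "jordan_blocks ks ^\<^sub>m m * R = R * JB m t a r" "adj R * (sip_blocks ks * R) = HB m t a r eps"
    "JB m t a r \<in> carrier_mat (blocks_dim ks) (blocks_dim ks)"
proof -
  let ?ls = "\<lambda>j i. if i \<le> r j then a j + 1 else a j"
  let ?k = "\<lambda>j. a j * m + r j" and ?N = "blocks_dim ks"
  let ?J = "\<lambda>j. diag_block_mat (map (\<lambda>i. jordan_block (?ls j i) (0::complex)) [1..<m+1])"
  let ?H = "\<lambda>j. diag_block_mat (map (\<lambda>i. of_int (eps j i) \<cdot>\<^sub>m Qmat (?ls j i)) [1..<m+1])"
  have set: "set [1..<t+1] = {1..t}" by auto
  let ?P = "\<lambda>j R. R \<in> carrier_mat (?k j) (?k j) \<and> map_mat cnj R = R \<and>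
     jordan_block (?k j) 0 ^\<^sub>m m * R = R * ?J j \<and> adj R * ((of_int (\<eta> j) \<cdot>\<^sub>m Qmat (?k j)) * R) = ?H j"
  have ex: "\<forall>j\<in>{1..t}. \<exists>R. ?P j R"
  proof
    fix j assume j: "j \<in> {1..t}"
    interpret power_block m "a j" "r j" using r[OF j] by unfold_locales auto
    have b': "balanced_signs (eps j) {1..r j} (\<eta> j)" "balanced_signs (eps j) {r j + 1..m} (\<eta> j)" using b[OF j] by auto
    show "\<exists>R. ?P j R" by (rule real_reduction[OF eps[OF j] \<eta>[OF j] b', unfolded k_def])
  qed
  from bchoice[OF ex] obtain Rj where Rj': "\<forall>j\<in>{1..t}. ?P j (Rj j)" ..
  note Rj = bspec[OF Rj']
  note R1 = conjunct1[OF Rj] and R2 = conjunct1[OF conjunct2[OF Rj]]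
    and R3 = conjunct1[OF conjunct2[OF conjunct2[OF Rj]]] and R4 = conjunct2[OF conjunct2[OF conjunct2[OF Rj]]]
  have R1': "dim_row (Rj j) = ?k j" "dim_col (Rj j) = ?k j" if "j \<in> {1..t}" for j
    using R1[OF that] by (rule carrier_matD)+
  have cong: "diag_block_mat (map f [1..<t+1]) = diag_block_mat (map g [1..<t+1])"
    if "\<And>j. j \<in> {1..t} \<Longrightarrow> f j = g j" for f g :: "nat \<Rightarrow> complex mat"
    by (rule arg_cong[of _ _ diag_block_mat], rule map_cong[OF refl], rule that, simp only: set)
  have mult: "diag_block_mat (map f [1..<t+1]) * diag_block_mat (map g [1..<t+1]) = diag_block_mat (map (\<lambda>j. f j * g j) [1..<t+1])"
    if "\<And>j. j \<in> {1..t} \<Longrightarrow> dim_col (f j) = dim_row (g j)" for f g :: "nat \<Rightarrow> complex mat"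
    by (rule diag_block_mat_mult, rule that, simp only: set)
  define R where "R = diag_block_mat (map Rj [1..<t+1])"
  have Rdims: "map dim_row (map Rj [1..<t+1]) = map ?k [1..<t+1]" "map dim_col (map Rj [1..<t+1]) = map ?k [1..<t+1]"
    unfolding map_map map_eq_conv set o_def using R1' by blast+
  have N: "?N = sum_list (map ?k [1..<t+1])" unfolding blocks_dim_def ks_def map_map o_def fst_conv ..
  have R: "R \<in> carrier_mat ?N ?N" unfolding R_def N
    by (rule carrier_matI) (simp_all only: dim_diag_block_mat Rdims)
  have cR: "map_mat cnj R = R"
    unfolding R_def cnj_diag_block_mat map_map o_def by (rule cong) (rule R2)
  have Jks: "jordan_blocks ks = diag_block_mat (map (\<lambda>j. jordan_block (?k j) 0) [1..<t+1])"
    unfolding jordan_blocks_def ks_def map_map o_def split ..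
  have Qks: "sip_blocks ks = diag_block_mat (map (\<lambda>j. of_int (\<eta> j) \<cdot>\<^sub>m Qmat (?k j)) [1..<t+1])"
    unfolding sip_blocks_def ks_def map_map o_def split ..
  have Jdim: "dim_row (?J j) = ?k j" if j: "j \<in> {1..t}" for j
  proof -
    interpret power_block m "a j" "r j" using r[OF j] by unfold_locales auto
    show ?thesis unfolding dim_diag_block_mat map_map o_def jordan_block_def dim_row_mat
      using sum_list_sizes unfolding k_def .
  qed
  have JR: "jordan_blocks ks ^\<^sub>m m * R = R * JB m t a r"
  proof -
    have "jordan_blocks ks ^\<^sub>m m = diag_block_mat (map (\<lambda>j. jordan_block (?k j) 0 ^\<^sub>m m) [1..<t+1])"
      unfolding Jks by (subst diag_block_pow_mat) (auto simp: o_def simp del: upt_Suc)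
    also have "\<dots> * R = diag_block_mat (map (\<lambda>j. jordan_block (?k j) 0 ^\<^sub>m m * Rj j) [1..<t+1])"
      unfolding R_def by (rule mult) (simp only: R1' jordan_block_pow_dim)
    also have "\<dots> = diag_block_mat (map (\<lambda>j. Rj j * ?J j) [1..<t+1])" by (rule cong) (rule R3)
    also have "\<dots> = R * JB m t a r"
      unfolding R_def JB_eq by (rule mult[symmetric]) (simp only: R1' Jdim)
    finally show ?thesis .
  qed
  have RQR: "adj R * (sip_blocks ks * R) = HB m t a r eps"
  proof -
    have 1: "sip_blocks ks * R = diag_block_mat (map (\<lambda>j. (of_int (\<eta> j) \<cdot>\<^sub>m Qmat (?k j)) * Rj j) [1..<t+1])"
      unfolding Qks R_def by (rule mult) (simp only: R1' index_smult_mat carrier_matD[OF Qmat_carrier])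
    have 2: "adj R = diag_block_mat (map (\<lambda>j. adj (Rj j)) [1..<t+1])"
      unfolding R_def adj_diag_block_mat map_map o_def ..
    have "adj R * (sip_blocks ks * R)
      = diag_block_mat (map (\<lambda>j. adj (Rj j) * ((of_int (\<eta> j) \<cdot>\<^sub>m Qmat (?k j)) * Rj j)) [1..<t+1])"
      unfolding 1 2 by (rule mult) (simp only: R1' adj_dim index_mult_mat index_smult_mat carrier_matD[OF Qmat_carrier])
    also have "\<dots> = HB m t a r eps" unfolding HB_eq by (rule cong) (rule R4)
    finally show ?thesis .
  qed
  have HB: "HB m t a r eps \<in> carrier_mat ?N ?N" unfolding RQR[symmetric] using R by auto
  have HH: "HB m t a r eps * HB m t a r eps = 1\<^sub>m ?N"
  proof -
    \<comment> \<open>Pairs (j,i) in the order of the nested list, so that the general lemma on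
      signed blocks applies to \<open>HB\<close>.\<close>
    let ?L = "concat (map (\<lambda>j. map (Pair j) [1..<m+1]) [1..<t+1])"
    have eq: "HB m t a r eps = diag_block_mat (map (\<lambda>p. of_int (eps (fst p) (snd p)) \<cdot>\<^sub>m Qmat (?ls (fst p) (snd p))) ?L)"
      unfolding HB_def map_concat map_map o_def fst_conv snd_conv ..
    define s where "s = sum_list (map (\<lambda>p. ?ls (fst p) (snd p)) ?L)"
    have sq: "HB m t a r eps * HB m t a r eps = 1\<^sub>m s"
      unfolding eq s_def
    proof (rule diag_smult_Qmat_mult_self)
      fix p assume "p \<in> set ?L"
      then have "fst p \<in> {1..t}" "snd p \<in> {1..m}" unfolding set_concat set_map set by auto
      then show "eps (fst p) (snd p) \<in> {1,-1}" by (rule eps)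
    qed
    have "s = ?N" using arg_cong[OF sq, of dim_row] carrier_matD(1)[OF HB] by simp
    with sq show ?thesis by simp
  qed
  define Ri where "Ri = HB m t a r eps * (adj R * sip_blocks ks)"
  have Ri: "Ri \<in> carrier_mat ?N ?N" unfolding Ri_def using R HB by auto
  have RiR: "Ri * R = 1\<^sub>m ?N"
  proof -
    note d = carrier_matD[OF R] carrier_matD[OF HB] blocks_dims adj_dim index_mult_mat
    have "Ri * R = HB m t a r eps * (adj R * (sip_blocks ks * R))"
      unfolding Ri_def by (simp only: mat_assoc d)
    then show ?thesis unfolding RQR HH .
  qed
  have RRi: "R * Ri = 1\<^sub>m ?N" by (rule mat_mult_left_right_inverse[OF Ri R RiR])
  have "JB m t a r \<in> carrier_mat ?N ?N"
  proof (rule carrier_matI)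
    show "dim_col (JB m t a r) = ?N"
      using arg_cong[OF JR, of dim_col] carrier_matD[OF R] by (simp only: index_mult_mat)
    have "map dim_row (map ?J [1..<t+1]) = map ?k [1..<t+1]"
      unfolding map_map map_eq_conv set o_def using Jdim by blast
    then show "dim_row (JB m t a r) = ?N" unfolding JB_eq dim_diag_block_mat(1) N by (simp only:)
  qed
  from that[OF R Ri RRi RiR cR JR RQR this] show ?thesis .
qed

section \<open>Nilpotency and the Segre characteristic\<close>

lemma diag_block_mat_zero:
  fixes Ms :: "'a :: zero mat list"
  assumes "\<And>M. M \<in> set Ms \<Longrightarrow> M = 0\<^sub>m (dim_row M) (dim_col M)"
  shows "diag_block_mat Ms = 0\<^sub>m (dim_row (diag_block_mat Ms)) (dim_col (diag_block_mat Ms))"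
  using assms
proof (induction Ms)
  case (Cons M Ms)
  define D where "D = diag_block_mat Ms"
  have D: "D = 0\<^sub>m (dim_row D) (dim_col D)" using Cons unfolding D_def by auto
  have M: "M = 0\<^sub>m (dim_row M) (dim_col M)" using Cons.prems by auto
  have "diag_block_mat (M # Ms) = four_block_mat M (0\<^sub>m (dim_row M) (dim_col D)) (0\<^sub>m (dim_row D) (dim_col M)) D"
    by (simp add: D_def Let_def)
  also have "\<dots> = 0\<^sub>m (dim_row M + dim_row D) (dim_col M + dim_col D)"
  proof -
    have "four_block_mat X (0\<^sub>m p s) (0\<^sub>m u q) Y = 0\<^sub>m (p + u) (q + s)"
      if "X = 0\<^sub>m p q" "Y = 0\<^sub>m u s" for X Y :: "'a mat" and p q u s using that by simp
    from this[OF M D] show ?thesis .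
  qed
  finally show ?case by simp
qed auto

lemma poly_char_product_root:
  assumes "(k, c) \<in> set xs" "k \<noteq> 0"
  shows "poly (\<Prod>(na, a)\<leftarrow>xs. [:- a, 1:] ^ na) c = (0::complex)"
  using assms by (induction xs) auto

text \<open>Every block of a Jordan form belongs to an eigenvalue of \<open>B\<close>, here 0, and a
  nilpotent block is killed by any power at least its size; the sum of all sizes serves as a common
  bound.\<close>

lemma nilpotent_of_spectrum:
  assumes B: "B \<in> carrier_mat d d" and sp: "spectrum B = {0}"
  obtains K where "B ^\<^sub>m K = 0\<^sub>m d d"
proof -
  obtain as where "char_poly B = (\<Prod>a\<leftarrow>as. [:- a, 1:])" using char_poly_factorized[OF B] by auto
  then obtain n_as where jnf: "jordan_nf B n_as" using jordan_nf_exists[OF B] by blast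
  obtain P Q where P: "P \<in> carrier_mat d d" and Q: "Q \<in> carrier_mat d d"
    and cp: "char_poly B = (\<Prod>(na, a)\<leftarrow>n_as. [:- a, 1:] ^ na)"
    and pow: "\<And>k. B ^\<^sub>m k = P * (jordan_matrix n_as) ^\<^sub>m k * Q"
    using jordan_nf_powE[OF B jnf] by metis
  define K where "K = sum_list (map fst n_as)"
  have zero: "c = 0 \<and> k \<le> K" if kc: "(k,c) \<in> set n_as" for k c
  proof
    have "k \<noteq> 0" using jnf kc unfolding jordan_nf_def by force
    then have "eigenvalue B c"
      unfolding eigenvalue_root_char_poly[OF B] cp using poly_char_product_root[OF kc] by simp
    then show "c = 0" using sp by (auto simp: spectrum_def)
    show "k \<le> K" unfolding K_def using kc by (intro member_le_sum_list) (force, simp)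
  qed
  define J where "J = jordan_matrix n_as ^\<^sub>m K"
  have J: "J = 0\<^sub>m (dim_row J) (dim_col J)"
    unfolding J_def jordan_matrix_pow
  proof (rule diag_block_mat_zero)
    fix M assume "M \<in> set (map (\<lambda>(n, a). jordan_block n a ^\<^sub>m K) n_as)"
    then obtain k c where kc: "(k,c) \<in> set n_as" and M: "M = jordan_block k c ^\<^sub>m K" by auto
    show "M = 0\<^sub>m (dim_row M) (dim_col M)"
      unfolding M using zero[OF kc] by (auto simp: jordan_block_zero_pow intro!: eq_matI)
  qed
  have "similar_mat B (jordan_matrix n_as)" using jnf by (simp add: jordan_nf_def)
  then have "jordan_matrix n_as \<in> carrier_mat d d"
    using B unfolding similar_mat_def similar_mat_wit_def Let_def by auto
  then have "J \<in> carrier_mat d d" unfolding J_def by (rule pow_carrier_mat)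
  then have "J = 0\<^sub>m d d" using J by auto
  then have "B ^\<^sub>m K = P * 0\<^sub>m d d * Q" using pow[of K] by (simp add: J_def)
  also have "\<dots> = 0\<^sub>m d d" using P Q by auto
  finally show ?thesis using that by blast
qed

text \<open>\<open>jordan_nf\<close> forbids blocks of size 0, whereas the tuples of the theorem may
  contain zeros; an empty block leaves a block-diagonal matrix unchanged.\<close>

lemma jordan_matrix_filter_nonzero:
  "jordan_matrix (map (\<lambda>k. (k, c)) (filter (\<lambda>k. k \<noteq> 0) ls)) = diag_block_mat (map (\<lambda>k. jordan_block k (c::complex)) ls)"
proof (induction ls)
  case (Cons k ls)
  define D where "D = diag_block_mat (map (\<lambda>k. jordan_block k c) ls)"
  show ?case
  proof (cases "k = 0")
    case True
    have "diag_block_mat (map (\<lambda>k. jordan_block k c) (k # ls)) = D"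
      unfolding True D_def[symmetric] list.map diag_block_mat.simps Let_def by (auto intro!: eq_matI)
    then show ?thesis using Cons True by (simp add: D_def)
  next
    case False
    then show ?thesis using Cons by (simp add: jordan_matrix_def)
  qed
qed (simp add: jordan_matrix_def)

text \<open>\<open>segre\<close> is a definite description, so its value needs uniqueness: the
  number of blocks of each positive size is determined by the matrix alone.\<close>

lemma segre_eqI:
  assumes "similar_mat B (diag_block_mat (map (\<lambda>k. jordan_block k 0) ls))"
  shows "segre B 0 = filter_mset (\<lambda>k. k \<noteq> 0) (mset ls)"
proof -
  let ?S = "\<lambda>n_as. mset (map fst (filter (\<lambda>p. snd p = (0::complex)) n_as))"
  define n_as where "n_as = map (\<lambda>k. (k, 0::complex)) (filter (\<lambda>k. k \<noteq> 0) ls)"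
  have jnf: "jordan_nf B n_as"
    using assms unfolding jordan_nf_def n_as_def jordan_matrix_filter_nonzero by auto
  have S: "?S n_as = filter_mset (\<lambda>k. k \<noteq> 0) (mset ls)"
    unfolding n_as_def by (simp add: filter_map o_def flip: mset_filter)
  have uniq: "?S m_bs = ?S n_as" if jnf': "jordan_nf B m_bs" for m_bs
  proof (rule multiset_eqI)
    fix k :: nat
    have cnt: "count (?S xs) k = length (filter ((=) (k, 0)) xs)" for xs
      by (induction xs) auto
    show "count (?S m_bs) k = count (?S n_as) k"
    proof (cases "k = 0")
      case True
      have "filter ((=) (k, 0)) xs = []" if "jordan_nf B xs" for xs
        using that True unfolding jordan_nf_def by (force simp: filter_empty_conv)
      then show ?thesis unfolding cnt using jnf jnf' by simp
    next
      case False
      show ?thesis unfolding cnt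
        using compute_nr_of_jordan_blocks[OF jnf False, of 0] compute_nr_of_jordan_blocks[OF jnf' False, of 0] by simp
    qed
  qed
  have "segre B 0 = ?S n_as" unfolding segre_def
    by (rule the_equality) (use jnf uniq in blast)+
  then show ?thesis using S by simp
qed

text \<open>\<open>Qmat k * jordan_block k 0\<close> has its ones where i + j = k, hence is real
  symmetric. This is the selfadjointness of the canonical Jordan matrix with respect to
  \<open>sip_blocks\<close>.\<close>

lemma sip_jordan_hermitian: "adj (sip_blocks ks * jordan_blocks ks) = sip_blocks ks * jordan_blocks ks"
proof -
  have eq: "sip_blocks ks * jordan_blocks ks = diag_block_mat (map (\<lambda>p. (of_int (snd p) \<cdot>\<^sub>m Qmat (fst p)) * jordan_block (fst p) 0) ks)"
    unfolding sip_blocks_def jordan_blocks_def case_prod_unfold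
    by (rule diag_block_mat_mult) (simp add: Qmat_def)
  have "adj ((of_int e \<cdot>\<^sub>m Qmat k) * jordan_block k 0) = (of_int e \<cdot>\<^sub>m Qmat k) * jordan_block k 0" for e :: int and k
  proof -
    define M where "M = Qmat k * jordan_block k 0"
    have M: "M \<in> carrier_mat k k" unfolding M_def by (rule mult_carrier_mat[OF Qmat_carrier jordan_block_carrier])
    have Mi: "M $$ (i,j) = (if i + j = k then 1 else 0)" if "i < k" "j < k" for i j
      unfolding M_def Qmat_mult_index[OF jordan_block_carrier that] using that by (auto simp: jordan_block_def)
    have "(of_int e \<cdot>\<^sub>m Qmat k) * jordan_block k 0 = of_int e \<cdot>\<^sub>m M"
      unfolding M_def by (rule mult_smult_assoc_mat) auto
    then show ?thesis using M Mi by (auto intro!: eq_matI simp: add.commute)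
  qed
  then show ?thesis unfolding eq adj_diag_block_mat map_map o_def by simp
qed

lemma double_reduction:
  fixes t m n :: nat and a r :: "nat \<Rightarrow> nat" and eps :: "nat \<Rightarrow> nat \<Rightarrow> int" and \<eta> :: "nat \<Rightarrow> int"
  assumes r: "\<And>j. j \<in> {1..t} \<Longrightarrow> 0 < r j \<and> r j \<le> m"
    and eps: "\<And>i j. j \<in> {1..t} \<Longrightarrow> i \<in> {1..m} \<Longrightarrow> eps j i \<in> {1,-1}"
    and \<eta>: "\<And>j. j \<in> {1..t} \<Longrightarrow> \<eta> j \<in> {1,-1}"
    and b: "\<And>j. j \<in> {1..t} \<Longrightarrow> balanced_signs (eps j) {1..r j} (\<eta> j) \<and> balanced_signs (eps j) {r j + 1..m} (\<eta> j)"
  defines "ks \<equiv> map (\<lambda>j. (a j * m + r j, \<eta> j)) [1..<t+1]"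
  defines "N \<equiv> blocks_dim ks"
  obtains D Di where "in_Omega N D" "Di \<in> carrier_mat (2*N) (2*N)" "D * Di = 1\<^sub>m (2*N)" "Di * D = 1\<^sub>m (2*N)"
    "diag_block_mat [jordan_blocks ks, jordan_blocks ks] ^\<^sub>m m * D = D * diag_block_mat [JB m t a r, JB m t a r]"
    "adj D * (diag_block_mat [sip_blocks ks, sip_blocks ks] * D) = diag_block_mat [HB m t a r eps, HB m t a r eps]"
    "JB m t a r \<in> carrier_mat N N"
proof -
  obtain R Ri where R: "R \<in> carrier_mat N N" "Ri \<in> carrier_mat N N"
    "R * Ri = 1\<^sub>m N" "Ri * R = 1\<^sub>m N" "map_mat cnj R = R"
    "jordan_blocks ks ^\<^sub>m m * R = R * JB m t a r" "adj R * (sip_blocks ks * R) = HB m t a r eps"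
    "JB m t a r \<in> carrier_mat N N"
    unfolding N_def ks_def by (rule real_reduction_sum[where a = a, OF r eps \<eta> b])
  have J: "jordan_blocks ks \<in> carrier_mat N N" and Q: "sip_blocks ks \<in> carrier_mat N N" by (auto simp: N_def)
  have Jm: "jordan_blocks ks ^\<^sub>m m \<in> carrier_mat N N" by (rule pow_carrier_mat[OF J])
  have QR: "sip_blocks ks * R \<in> carrier_mat N N" using Q R(1) by (rule mult_carrier_mat)
  show ?thesis
  proof (rule that[of "diag_block_mat [R,R]" "diag_block_mat [Ri,Ri]"])
    show "in_Omega N (diag_block_mat [R,R])" by (rule in_Omega_double[OF R(1,5)])
    show "diag_block_mat [Ri,Ri] \<in> carrier_mat (2*N) (2*N)" unfolding mult_2 by (rule diag_block_mat_pair_carrier[OF R(2) R(2)])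
    show "diag_block_mat [R,R] * diag_block_mat [Ri,Ri] = 1\<^sub>m (2*N)"
      unfolding diag_block_mat_pair_mult[OF R(1) R(1) R(2) R(2)] R(3) diag_block_mat_pair_one mult_2 ..
    show "diag_block_mat [Ri,Ri] * diag_block_mat [R,R] = 1\<^sub>m (2*N)"
      unfolding diag_block_mat_pair_mult[OF R(2) R(2) R(1) R(1)] R(4) diag_block_mat_pair_one mult_2 ..
    have "diag_block_mat [jordan_blocks ks, jordan_blocks ks] ^\<^sub>m m = diag_block_mat [jordan_blocks ks ^\<^sub>m m, jordan_blocks ks ^\<^sub>m m]"
      using J by (subst diag_block_pow_mat) (auto simp del: diag_block_mat.simps)
    then show "diag_block_mat [jordan_blocks ks, jordan_blocks ks] ^\<^sub>m m * diag_block_mat [R,R]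
       = diag_block_mat [R,R] * diag_block_mat [JB m t a r, JB m t a r]"
      by (simp only: diag_block_mat_pair_mult[OF Jm Jm R(1) R(1)] diag_block_mat_pair_mult[OF R(1) R(1) R(8) R(8)] R(6))
    have "adj (diag_block_mat [R,R]) = diag_block_mat [adj R, adj R]"
      unfolding adj_diag_block_mat list.map ..
    then show "adj (diag_block_mat [R,R]) * (diag_block_mat [sip_blocks ks, sip_blocks ks] * diag_block_mat [R,R])
       = diag_block_mat [HB m t a r eps, HB m t a r eps]"
      by (simp only: diag_block_mat_pair_mult[OF Q Q R(1) R(1)]
        diag_block_mat_pair_mult[OF adj_carrier[OF R(1)] adj_carrier[OF R(1)] QR QR] R(7))
    show "JB m t a r \<in> carrier_mat N N" by (rule R(8))
  qed
qed

lemma pow_mat_mult: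
  assumes "A \<in> carrier_mat d d"
  shows "(A ^\<^sub>m p) ^\<^sub>m q = (A ^\<^sub>m (p * q) :: complex mat)"
  by (induction q) (use assms in \<open>simp_all add: pow_mat_add[OF assms, symmetric] add.commute\<close>)

text \<open>Justifies the signs chosen when passing from a root to its power. The offset
  \<open>c\<close> lets one statement serve both groups of a tuple.\<close>

lemma balanced_initial_signs:
  assumes \<eta>: "\<eta> \<in> {1,-1}" and e: "\<And>i. i \<in> {c+1..c+s} \<Longrightarrow> e i = (if i - c \<le> (s + 1) div 2 then \<eta> else - \<eta>)"
  shows "balanced_signs e {c+1..c+s} \<eta>"
proof -
  have "\<eta> \<noteq> - \<eta>" using \<eta> by auto
  have "{i \<in> {c+1..c+s}. e i = \<eta>} = {c+1..c+(s+1) div 2}"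
  proof (intro Set.set_eqI iffI)
    fix i assume "i \<in> {i \<in> {c+1..c+s}. e i = \<eta>}"
    then show "i \<in> {c+1..c+(s+1) div 2}" using e[of i] \<open>\<eta> \<noteq> - \<eta>\<close> by (auto split: if_splits)
  next
    fix i assume i: "i \<in> {c+1..c+(s+1) div 2}"
    then have "i \<in> {c+1..c+s}" by auto
    then show "i \<in> {i \<in> {c+1..c+s}. e i = \<eta>}" using i e[of i] by auto
  qed
  moreover have "{i \<in> {c+1..c+s}. e i = - \<eta>} = {c+(s+1) div 2+1..c+s}"
  proof (intro Set.set_eqI iffI)
    fix i assume "i \<in> {i \<in> {c+1..c+s}. e i = - \<eta>}"
    then show "i \<in> {c+(s+1) div 2+1..c+s}" using e[of i] \<open>\<eta> \<noteq> - \<eta>\<close> by (auto split: if_splits)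
  next
    fix i assume i: "i \<in> {c+(s+1) div 2+1..c+s}"
    then have "i \<in> {c+1..c+s}" by auto
    then show "i \<in> {i \<in> {c+1..c+s}. e i = - \<eta>}" using i e[of i] by auto
  qed
  ultimately show ?thesis unfolding balanced_signs_def by (auto elim!: oddE)
qed

section \<open>Existence of roots\<close>

lemma tuple_eq: "r \<le> m \<Longrightarrow> tuple m a r = map (\<lambda>i. if i \<le> r then a + 1 else a) [1..<m+1]"
  unfolding tuple_def by (rule nth_equalityI) (auto simp: nth_append simp del: upt_Suc)

text \<open>Flattening the nested list gives one list of block sizes, zeros included; the doubled
  matrix corresponds to this list appended to itself.\<close>

lemma segre_of_reduction:
  assumes r: "\<And>j. j \<in> {1..t} \<Longrightarrow> r j \<le> m"
    and sim: "similar_mat B (diag_block_mat [JB m t a r, JB m t a r])"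
  shows "filter_mset (\<lambda>x. x \<noteq> 0)
      (\<Sum>j\<in>#mset [1..<t+1]. mset (tuple m (a j) (r j)) + mset (tuple m (a j) (r j))) = segre B 0"
proof -
  define L where "L = concat (map (\<lambda>j. map (\<lambda>i. if i \<le> r j then a j + 1 else a j) [1..<m+1]) [1..<t+1])"
  have JB: "JB m t a r = diag_block_mat (map (\<lambda>k. jordan_block k 0) L)"
    unfolding JB_def L_def map_concat map_map o_def ..
  have "diag_block_mat (map (\<lambda>k. jordan_block k 0) (L @ L)) = diag_block_mat [JB m t a r, JB m t a r]"
    unfolding map_append diag_block_mat_append diag_block_mat_pair Let_def JB ..
  with sim have "similar_mat B (diag_block_mat (map (\<lambda>k. jordan_block k 0) (L @ L)))" by simp
  note segre_eqI[OF this]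
  moreover have "L = concat (map (\<lambda>j. tuple m (a j) (r j)) [1..<t+1])"
  proof -
    have set: "set [1..<t+1] = {1..t}" by auto
    show ?thesis unfolding L_def
      by (rule arg_cong[of _ _ concat], rule map_cong[OF refl], unfold set) (simp only: tuple_eq r)
  qed
  then have "mset L = (\<Sum>j\<in>#mset [1..<t+1]. mset (tuple m (a j) (r j)))"
    by (simp add: mset_concat o_def sum_mset_sum_list[symmetric] del: upt_Suc)
  ultimately show ?thesis by (simp add: sum_mset.distrib del: upt_Suc)
qed

lemma segre_pairable_of_tuples:
  assumes r: "\<And>j. j \<in> {1..t} \<Longrightarrow> r j \<le> m"
    and S: "filter_mset (\<lambda>x. x \<noteq> 0)
      (\<Sum>j\<in>#mset [1..<t+1]. mset (tuple m (a j) (r j)) + mset (tuple m (a j) (r j))) = S"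
  shows "segre_pairable m S"
proof -
  \<comment> \<open>Each tuple once; \<open>segre_pairable\<close> itself supplies the second copy
    through \<open>K + K\<close>.\<close>
  let ?K = "image_mset (\<lambda>j. tuple m (a j) (r j)) (mset [1..<t+1])"
  have "(\<Sum>\<tau>\<in>#(?K + ?K). mset \<tau>) = (\<Sum>j\<in>#mset [1..<t+1]. mset (tuple m (a j) (r j)) + mset (tuple m (a j) (r j)))"
    by (simp add: sum_mset.distrib image_mset.compositionality o_def del: upt_Suc mset_upt)
  moreover have "length \<tau> = m \<and> (\<forall>x\<in>set \<tau>. \<forall>y\<in>set \<tau>. x \<le> y + 1)" if "\<tau> \<in># ?K" for \<tau>
  proof -
    have "\<tau> \<in> (\<lambda>j. tuple m (a j) (r j)) ` set [1..<t+1]"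
      using that by (simp only: set_image_mset set_mset_mset)
    then obtain j where "j \<in> set [1..<t+1]" and \<tau>: "\<tau> = tuple m (a j) (r j)" by blast
    then have j: "j \<in> {1..t}" by auto
    show ?thesis unfolding \<tau> tuple_def using r[OF j] by auto
  qed
  ultimately show ?thesis unfolding segre_pairable_def using S by (intro exI[of _ ?K]) (simp del: upt_Suc mset_upt)
qed

text \<open>The transformation is \<open>S * D\<close>: \<open>S\<close> brings the root to
  canonical form and hence \<open>B\<close> to the power of canonical blocks, and \<open>D\<close>
  splits these blocks.\<close>

lemma root_imp_reduction:
  assumes m: "m \<ge> 1" and H: "in_Omega n H" "invertible_mat H" "hermitian H"
    and B: "in_Omega n B" and sp: "spectrum B = {0}"
    and A: "in_Omega n A" "H_selfadjoint H A" "A ^\<^sub>m m = B"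
  shows "\<exists>(t::nat) (a::nat \<Rightarrow> nat) (r::nat \<Rightarrow> nat) (eps::nat \<Rightarrow> nat \<Rightarrow> int) S Sinv.
        (\<forall>j\<in>{1..t}. 0 < r j \<and> r j \<le> m) \<and>
        (\<forall>j\<in>{1..t}. \<forall>i\<in>{1..m}. eps j i \<in> {1, -1}) \<and>
        filter_mset (\<lambda>x. x \<noteq> 0)
          (\<Sum>j\<in>#mset [1..<t+1]. mset (tuple m (a j) (r j)) + mset (tuple m (a j) (r j)))
          = segre B 0 \<and>
        in_Omega n S \<and> Sinv \<in> carrier_mat (2*n) (2*n) \<and>
        S * Sinv = 1\<^sub>m (2*n) \<and> Sinv * S = 1\<^sub>m (2*n) \<and>
        Sinv * B * S = diag_block_mat [JB m t a r, JB m t a r] \<and>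
        adj S * H * S = diag_block_mat [HB m t a r eps, HB m t a r eps] \<and>
        (\<forall>j\<in>{1..t}. \<exists>\<eta>\<in>{1, -1::int}.
           balanced_signs (eps j) {1..r j} \<eta> \<and> balanced_signs (eps j) {r j + 1..m} \<eta>)"
proof -
  interpret quat_selfadjoint n H A using H A by unfold_locales auto
  have Bc: "B \<in> carrier_mat (2*n) (2*n)" by (rule in_Omega_carrier[OF B])
  obtain K where "B ^\<^sub>m K = 0\<^sub>m (2*n) (2*n)" using nilpotent_of_spectrum[OF Bc sp] .
  then have nil: "A ^\<^sub>m (m * K) = 0\<^sub>m (2*n) (2*n)" using A(3) pow_mat_mult[OF A_carrier, of m K] by simp
  obtain S T ks where S: "in_Omega n S" and T: "T \<in> carrier_mat (2*n) (2*n)"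
    and ST: "S * T = 1\<^sub>m (2*n)" and TS: "T * S = 1\<^sub>m (2*n)"
    and N: "blocks_dim ks = n" and ks': "\<forall>(k,e)\<in>set ks. 0 < k \<and> e \<in> {1,-1}"
    and TAS: "T * A * S = diag_block_mat [jordan_blocks ks, jordan_blocks ks]"
    and SHS: "adj S * H * S = diag_block_mat [sip_blocks ks, sip_blocks ks]"
    using canonical_form[OF nil] .
  define t where "t = length ks"
  define k where "k j = fst (ks ! (j - 1))" for j
  define \<eta> where "\<eta> j = snd (ks ! (j - 1))" for j
  \<comment> \<open>Division with remainder in 1..m instead of 0..m-1, as the theorem demands
    \<open>0 < r j\<close>; hence the shifts by one.\<close>
  define a where "a j = (k j - 1) div m" for j
  define r where "r j = (k j - 1) mod m + 1" for j
  define eps where "eps j i = (if i \<le> r j then (if i \<le> (r j + 1) div 2 then \<eta> j else - \<eta> j)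
     else (if i - r j \<le> (m - r j + 1) div 2 then \<eta> j else - \<eta> j))" for j i
  have kj: "0 < k j \<and> \<eta> j \<in> {1,-1}" if "j \<in> {1..t}" for j
  proof -
    have "ks ! (j - 1) \<in> set ks" using that by (auto simp: t_def)
    then show ?thesis using ks' by (auto simp: k_def \<eta>_def case_prod_unfold)
  qed
  have r: "0 < r j \<and> r j \<le> m" for j
    using m mod_less_divisor[of m "k j - 1"] by (simp add: r_def Suc_le_eq)
  have ark: "a j * m + r j = k j" if "j \<in> {1..t}" for j
    using kj[OF that] by (simp add: a_def r_def)
  have ks: "ks = map (\<lambda>j. (a j * m + r j, \<eta> j)) [1..<t+1]"
  proof (rule nth_equalityI)
    fix i assume i: "i < length ks"
    then have "Suc i \<in> {1..t}" by (auto simp: t_def)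
    from ark[OF this] show "ks ! i = map (\<lambda>j. (a j * m + r j, \<eta> j)) [1..<t+1] ! i"
      using i by (simp add: t_def k_def \<eta>_def del: upt_Suc)
  qed (simp add: t_def del: upt_Suc)
  have eps: "eps j i \<in> {1,-1}" if "j \<in> {1..t}" for i j using kj[OF that] by (auto simp: eps_def)
  have b: "balanced_signs (eps j) {1..r j} (\<eta> j) \<and> balanced_signs (eps j) {r j + 1..m} (\<eta> j)" if "j \<in> {1..t}" for j
  proof
    show "balanced_signs (eps j) {1..r j} (\<eta> j)"
      using balanced_initial_signs[of "\<eta> j" 0 "r j" "eps j"] kj[OF that] by (simp add: eps_def)
    show "balanced_signs (eps j) {r j + 1..m} (\<eta> j)"
      using balanced_initial_signs[of "\<eta> j" "r j" "m - r j" "eps j"] kj[OF that] r[of j] by (simp add: eps_def)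
  qed
  define J2 Q2 where "J2 = diag_block_mat [jordan_blocks ks, jordan_blocks ks]"
    and "Q2 = diag_block_mat [sip_blocks ks, sip_blocks ks]"
  obtain D Di where D: "in_Omega n D" and Di: "Di \<in> carrier_mat (2*n) (2*n)"
    and DDi: "D * Di = 1\<^sub>m (2*n)" and DiD: "Di * D = 1\<^sub>m (2*n)"
    and JD: "J2 ^\<^sub>m m * D = D * diag_block_mat [JB m t a r, JB m t a r]"
    and DQD: "adj D * (Q2 * D) = diag_block_mat [HB m t a r eps, HB m t a r eps]"
    and JBc: "JB m t a r \<in> carrier_mat n n"
    using double_reduction[where a = a and m = m and t = t and r = r and eps = eps and \<eta> = \<eta>,
      OF r eps conjunct2[OF kj] b, folded ks, unfolded N]
    unfolding J2_def Q2_def .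
  have Sc: "S \<in> carrier_mat (2*n) (2*n)" and Dc: "D \<in> carrier_mat (2*n) (2*n)"
    using S D by (auto intro: in_Omega_carrier)
  define JB2 where "JB2 = diag_block_mat [JB m t a r, JB m t a r]"
  have JB2: "JB2 \<in> carrier_mat (2*n) (2*n)" unfolding JB2_def mult_2 by (rule diag_block_mat_pair_carrier[OF JBc JBc])
  have J2c: "J2 \<in> carrier_mat (2*n) (2*n)" unfolding J2_def TAS[symmetric] using Sc T by auto
  note dims = carrier_matD[OF Sc] carrier_matD[OF Dc] carrier_matD[OF T] carrier_matD[OF Di] carrier_matD[OF Bc]
    carrier_matD[OF JB2] H_dim A_dim adj_dim index_mult_mat(2,3)
  have "similar_mat_wit J2 A T S" using TAS TS ST T Sc J2c
    unfolding similar_mat_wit_def Let_def J2_def[symmetric] by auto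
  then have TBS: "T * B * S = J2 ^\<^sub>m m" using similar_mat_wit_pow_id A(3) by metis
  have 1: "in_Omega n (S * D)" by (rule in_Omega_mult[OF S D])
  have 2: "Di * T \<in> carrier_mat (2*n) (2*n)" using Di T by auto
  have 4: "Di * T * (S * D) = 1\<^sub>m (2*n)"
  proof -
    have "Di * T * (S * D) = Di * (T * S * D)" by (simp only: mat_assoc dims)
    then show ?thesis unfolding TS using Dc DiD by simp
  qed
  have 3: "S * D * (Di * T) = 1\<^sub>m (2*n)"
    by (rule mat_mult_left_right_inverse[OF 2 _ 4]) (use Sc Dc in auto)
  have 5: "Di * T * B * (S * D) = JB2"
  proof -
    have "Di * T * B * (S * D) = Di * (T * B * S * D)" by (simp only: mat_assoc dims)
    also have "\<dots> = Di * (D * JB2)" unfolding TBS JD JB2_def ..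
    also have "\<dots> = Di * D * JB2" by (simp only: mat_assoc dims)
    finally show ?thesis unfolding DiD using JB2 by simp
  qed
  have 6: "adj (S * D) * H * (S * D) = diag_block_mat [HB m t a r eps, HB m t a r eps]"
  proof -
    have "adj (S * D) * H * (S * D) = adj D * (adj S * H * S * D)"
      by (simp only: mat_assoc dims adj_mult)
    then show ?thesis unfolding SHS Q2_def[symmetric] DQD .
  qed
  have "similar_mat B JB2"
  proof -
    have SDc: "S * D \<in> carrier_mat (2*n) (2*n)" using Sc Dc by auto
    have "similar_mat_wit JB2 B (Di * T) (S * D)"
      unfolding similar_mat_wit_def Let_def using 2 3 4 5 SDc Bc JB2 by auto
    then show ?thesis using similar_mat_sym unfolding similar_mat_def by blast
  qed
  from segre_of_reduction[OF conjunct2[OF r] this[unfolded JB2_def]]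
  have 7: "filter_mset (\<lambda>x. x \<noteq> 0)
      (\<Sum>j\<in>#mset [1..<t+1]. mset (tuple m (a j) (r j)) + mset (tuple m (a j) (r j))) = segre B 0" .
  have 8: "\<forall>j\<in>{1..t}. \<exists>\<eta>\<in>{1, -1::int}.
     balanced_signs (eps j) {1..r j} \<eta> \<and> balanced_signs (eps j) {r j + 1..m} \<eta>" using b kj by blast
  show ?thesis
    by (rule exI[of _ t], rule exI[of _ a], rule exI[of _ r], rule exI[of _ eps],
      rule exI[of _ "S * D"], rule exI[of _ "Di * T"], intro conjI ballI)
      (use r eps 1 2 3 4 5[unfolded JB2_def] 6 7 8 in \<open>blast | assumption\<close>)+
qed

text \<open>In coordinates where \<open>B\<close> is the \<open>m\<close>-th power of the canonical
  Jordan matrix, that matrix itself is the root. These coordinates are \<open>S * Di\<close>, the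
  given ones followed by the undone splitting, and both factors lie in Omega.\<close>

lemma reduction_imp_root:
  assumes H: "in_Omega n H" "hermitian H" and B: "in_Omega n B"
    and r: "\<And>j. j \<in> {1..t} \<Longrightarrow> 0 < r j \<and> r j \<le> m"
    and eps: "\<And>i j. j \<in> {1..t} \<Longrightarrow> i \<in> {1..m} \<Longrightarrow> eps j i \<in> {1,-1}"
    and S: "in_Omega n S" and T: "T \<in> carrier_mat (2*n) (2*n)"
    and ST: "S * T = 1\<^sub>m (2*n)" and TS: "T * S = 1\<^sub>m (2*n)"
    and TBS: "T * B * S = diag_block_mat [JB m t a r, JB m t a r]"
    and SHS: "adj S * H * S = diag_block_mat [HB m t a r eps, HB m t a r eps]"
    and b: "\<forall>j\<in>{1..t}. \<exists>\<eta>\<in>{1, -1::int}.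
           balanced_signs (eps j) {1..r j} \<eta> \<and> balanced_signs (eps j) {r j + 1..m} \<eta>"
  shows "\<exists>A. in_Omega n A \<and> H_selfadjoint H A \<and> A ^\<^sub>m m = B"
proof -
  from b have "\<forall>j\<in>{1..t}. \<exists>\<eta>. \<eta> \<in> {1,-1::int} \<and> (balanced_signs (eps j) {1..r j} \<eta> \<and> balanced_signs (eps j) {r j + 1..m} \<eta>)"
    by blast
  from bchoice[OF this] obtain \<eta> where \<eta>: "\<forall>j\<in>{1..t}. \<eta> j \<in> {1,-1::int} \<and>
     (balanced_signs (eps j) {1..r j} (\<eta> j) \<and> balanced_signs (eps j) {r j + 1..m} (\<eta> j))" ..
  note \<eta>1 = conjunct1[OF bspec[OF \<eta>]] and \<eta>2 = conjunct2[OF bspec[OF \<eta>]]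
  define ks where "ks = map (\<lambda>j. (a j * m + r j, \<eta> j)) [1..<t+1]"
  define N where "N = blocks_dim ks"
  define J2 Q2 JB2 where "J2 = diag_block_mat [jordan_blocks ks, jordan_blocks ks]"
    and "Q2 = diag_block_mat [sip_blocks ks, sip_blocks ks]"
    and "JB2 = diag_block_mat [JB m t a r, JB m t a r]"
  obtain D Di where D: "in_Omega N D" and Di: "Di \<in> carrier_mat (2*N) (2*N)"
    and DDi: "D * Di = 1\<^sub>m (2*N)" and DiD: "Di * D = 1\<^sub>m (2*N)"
    and JD: "J2 ^\<^sub>m m * D = D * JB2"
    and DQD: "adj D * (Q2 * D) = diag_block_mat [HB m t a r eps, HB m t a r eps]"
    and JBc: "JB m t a r \<in> carrier_mat N N"
    using double_reduction[where a = a and m = m, OF r eps \<eta>1 \<eta>2]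
    unfolding J2_def Q2_def JB2_def N_def ks_def .
  have Bc: "B \<in> carrier_mat (2*n) (2*n)" and Sc: "S \<in> carrier_mat (2*n) (2*n)" and Hc: "H \<in> carrier_mat (2*n) (2*n)"
    using B S H by (auto intro: in_Omega_carrier)
  have "JB2 \<in> carrier_mat (N + N) (N + N)" unfolding JB2_def by (rule diag_block_mat_pair_carrier[OF JBc JBc])
  moreover have "JB2 \<in> carrier_mat (2*n) (2*n)" unfolding JB2_def TBS[symmetric] using Bc Sc T by auto
  \<comment> \<open>The total size of the list \<open>ks\<close> is not given; it is found by
    comparing two expressions for the dimension of \<open>JB2\<close>.\<close>
  ultimately have N: "N = n" by auto
  note D = D[unfolded N] and Di = Di[unfolded N] and DDi = DDi[unfolded N] and DiD = DiD[unfolded N]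
  have Dc: "D \<in> carrier_mat (2*n) (2*n)" by (rule in_Omega_carrier[OF D])
  have Jn: "jordan_blocks ks \<in> carrier_mat n n" and Qn: "sip_blocks ks \<in> carrier_mat n n"
    using N by (auto simp: N_def)
  have J2c: "J2 \<in> carrier_mat (2*n) (2*n)" unfolding J2_def mult_2 by (rule diag_block_mat_pair_carrier[OF Jn Jn])
  have Q2c: "Q2 \<in> carrier_mat (2*n) (2*n)" unfolding Q2_def mult_2 by (rule diag_block_mat_pair_carrier[OF Qn Qn])
  have JB2c: "JB2 \<in> carrier_mat (2*n) (2*n)" by fact
  have J2O: "in_Omega n J2" unfolding J2_def by (rule in_Omega_double[OF Jn cnj_jordan_blocks])
  have adjH: "adj H = H" using H by (simp add: hermitian_def)
  define U Ui where "U = S * Di" and "Ui = D * T"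
  have DiO: "in_Omega n Di" by (rule in_Omega_inverse[OF D Di DDi DiD])
  have U: "in_Omega n U" unfolding U_def by (rule in_Omega_mult[OF S DiO])
  have Uc: "U \<in> carrier_mat (2*n) (2*n)" by (rule in_Omega_carrier[OF U])
  have Uic: "Ui \<in> carrier_mat (2*n) (2*n)" unfolding Ui_def using Dc T by auto
  have J2mc: "J2 ^\<^sub>m m \<in> carrier_mat (2*n) (2*n)" by (rule pow_carrier_mat[OF J2c])
  note dims = carrier_matD[OF Sc] carrier_matD[OF Dc] carrier_matD[OF T] carrier_matD[OF Di] carrier_matD[OF Bc]
    carrier_matD[OF JB2c] carrier_matD[OF Hc] carrier_matD[OF J2c] carrier_matD[OF Q2c] carrier_matD[OF Uc]
    carrier_matD[OF Uic] carrier_matD[OF J2mc] adj_dim index_mult_mat(2,3)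
  have UiU: "Ui * U = 1\<^sub>m (2*n)"
  proof -
    have "Ui * U = D * (T * S * Di)" unfolding U_def Ui_def by (simp only: mat_assoc dims)
    then show ?thesis unfolding TS using Di DDi by simp
  qed
  have UUi: "U * Ui = 1\<^sub>m (2*n)" by (rule mat_mult_left_right_inverse[OF Uic Uc UiU])
  have UiO: "in_Omega n Ui" by (rule in_Omega_inverse[OF U Uic UUi UiU])
  have adj1: "adj (1\<^sub>m (2*n)) = 1\<^sub>m (2*n)" by (rule eq_matI) auto
  define A where "A = U * J2 * Ui"
  have AO: "in_Omega n A" unfolding A_def by (intro in_Omega_mult U J2O UiO)
  have Ac: "A \<in> carrier_mat (2*n) (2*n)" by (rule in_Omega_carrier[OF AO])
  have "similar_mat_wit A J2 U Ui" unfolding similar_mat_wit_def Let_def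
    using Ac J2c Uc Uic UUi UiU A_def by auto
  then have "A ^\<^sub>m m = U * J2 ^\<^sub>m m * Ui" by (rule similar_mat_wit_pow_id)
  also have "\<dots> = S * (Di * (J2 ^\<^sub>m m * D)) * T" unfolding U_def Ui_def by (simp only: mat_assoc dims)
  also have "\<dots> = S * (Di * D * JB2) * T" unfolding JD by (simp only: mat_assoc dims)
  also have "\<dots> = S * (T * B * S) * T" unfolding DiD TBS JB2_def[symmetric] using JB2c by simp
  also have "\<dots> = (S * T) * B * (S * T)" by (simp only: mat_assoc dims)
  also have "\<dots> = B" unfolding ST using Bc by simp
  finally have Am: "A ^\<^sub>m m = B" .
  have UHU: "adj U * (H * U) = Q2"
  proof -
    have "adj U * (H * U) = adj Di * (adj S * H * S * Di)" unfolding U_def by (simp only: adj_mult mat_assoc dims)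
    also have "\<dots> = adj Di * (adj D * (Q2 * D) * Di)" unfolding SHS DQD ..
    also have "\<dots> = adj (D * Di) * (Q2 * (D * Di))" by (simp only: adj_mult mat_assoc dims)
    finally show ?thesis unfolding DDi adj1 using Q2c by simp
  qed
  have HU: "H * U = adj Ui * Q2"
  proof -
    have "adj Ui * Q2 = adj (U * Ui) * (H * U)" unfolding UHU[symmetric] by (simp only: adj_mult mat_assoc dims)
    then show ?thesis unfolding UUi adj1 using Hc Uc by simp
  qed
  \<comment> \<open>Written as a congruence by \<open>Ui\<close>, so that \<open>H * A\<close> is
    Hermitian as soon as \<open>Q2 * J2\<close> is.\<close>
  have HA: "H * A = adj Ui * (Q2 * J2) * Ui"
  proof -
    have "H * A = H * U * J2 * Ui" unfolding A_def by (simp only: mat_assoc dims)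
    then show ?thesis unfolding HU by (simp only: mat_assoc dims)
  qed
  have QJ: "adj (Q2 * J2) = Q2 * J2"
    unfolding Q2_def J2_def diag_block_mat_pair_mult[OF Qn Qn Jn Jn] adj_diag_block_mat list.map sip_jordan_hermitian ..
  have "adj A * H = adj (H * A)" using Ac Hc by (simp add: adj_mult adjH)
  also have "\<dots> = adj Ui * adj (Q2 * J2) * Ui" unfolding HA by (simp only: adj_mult mat_assoc dims adj_adj)
  also have "\<dots> = H * A" unfolding QJ HA ..
  finally have "H_selfadjoint H A" by (simp add: H_selfadjoint_def)
  with AO Am show ?thesis by blast
qed

theorem mainTheorem10:
  fixes n m :: nat and H B :: "complex mat"
  assumes "m \<ge> 1"
    and "in_Omega n H" and "invertible_mat H" and "hermitian H"
    and "in_Omega n B" and "H_selfadjoint H B" and "spectrum B = {0}"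
  shows "(\<exists>A. in_Omega n A \<and> H_selfadjoint H A \<and> A ^\<^sub>m m = B) \<longleftrightarrow>
    (segre_pairable m (segre B 0) \<and>
     (\<exists>(t::nat) (a::nat \<Rightarrow> nat) (r::nat \<Rightarrow> nat) (eps::nat \<Rightarrow> nat \<Rightarrow> int) S Sinv.
        (\<forall>j\<in>{1..t}. 0 < r j \<and> r j \<le> m) \<and>
        (\<forall>j\<in>{1..t}. \<forall>i\<in>{1..m}. eps j i \<in> {1, -1}) \<and>
        filter_mset (\<lambda>x. x \<noteq> 0)
          (\<Sum>j\<in>#mset [1..<t+1]. mset (tuple m (a j) (r j)) + mset (tuple m (a j) (r j)))
          = segre B 0 \<and>
        in_Omega n S \<and> Sinv \<in> carrier_mat (2*n) (2*n) \<and>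
        S * Sinv = 1\<^sub>m (2*n) \<and> Sinv * S = 1\<^sub>m (2*n) \<and>
        Sinv * B * S = diag_block_mat [JB m t a r, JB m t a r] \<and>
        adj S * H * S = diag_block_mat [HB m t a r eps, HB m t a r eps] \<and>
        (\<forall>j\<in>{1..t}. \<exists>\<eta>\<in>{1, -1::int}.
           balanced_signs (eps j) {1..r j} \<eta> \<and> balanced_signs (eps j) {r j + 1..m} \<eta>)))"
    (is "?L \<longleftrightarrow> ?P \<and> ?R")
proof
  assume ?L
  then obtain A where A: "in_Omega n A" "H_selfadjoint H A" "A ^\<^sub>m m = B" by blast
  have R: ?R by (rule root_imp_reduction[OF assms(1-5,7) A])
  then obtain t :: nat and a r :: "nat \<Rightarrow> nat" where "\<forall>j\<in>{1..t}. 0 < r j \<and> r j \<le> m"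
    and S: "filter_mset (\<lambda>x. x \<noteq> 0)
      (\<Sum>j\<in>#mset [1..<t+1]. mset (tuple m (a j) (r j)) + mset (tuple m (a j) (r j))) = segre B 0"
    by (elim exE conjE) (rule that)
  \<comment> \<open>The tuples of condition 2 are themselves a reordering as asked for in condition
    1.\<close>
  then have "?P" by (intro segre_pairable_of_tuples[OF _ S]) blast
  with R show "?P \<and> ?R" by (rule conjI[rotated])
next
  assume "?P \<and> ?R"
  then have ?R by (rule conjunct2)
  then show ?L
    by (elim exE conjE) (rule reduction_imp_root[OF assms(2,4,5)]; (blast | assumption))
qed

end
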